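(* Let $\{\varphi_r\}_{0<r<1}$ be a regular approximate identity and let $\lambda:(0,1)\to(0,\infty)$ with $\lim_{r\to1}\lambda(r)=0$ satisfy $$\Pi(\lambda,\varphi)=\limsup_{r\to1}\lambda(r)\|\varphi_r\|_\infty<\infty .$$ If $\mu\in \mathrm{BV}(\mathbb T)$ is differentiable at $x_0\in\mathbb T$, then $$\lim_{\substack{r\to1\\ x\in\lambda(r,x_0)}}\Phi_r(x,d\mu)=\mu'(x_0).$$
   Context: $\mathbb T=\mathbb R/2\pi\mathbb Z$, identified with an interval of length $2\pi$; points are represented by $t$ with $|t|\le\pi$. An approximate identity is a family $\{\varphi_r\}_{0<r<1}\subset L^\infty(\mathbb T)$ such that: ($\Phi1$) $\int_{\mathbb T}\varphi_r(t)\,dt\to1$ as $r\to1$; ($\Phi2$) $\varphi_r^*(x):=\sup_{|x|\le|t|\le\pi}|\varphi_r(t)|\to0$ as $r\to1$ for each $0<|x|\le\pi$; ($\Phi3$) $C_\varphi:=\sup_{0<r<1}\|\varphi_r^*\|_1<\infty$. It is regular if each $\varphi_r$ is non-negative, decreasing on $[0,\pi]$ and increasing on $[-\pi,0]$ (the functions are taken as pointwise defined). $\mathrm{BV}(\mathbb T)$ is the class of functions of bounded variation on $\mathbb T$ (i.e. on a period interval; $\mu$ is used only through the finite Borel measure $d\mu$ on $\mathbb T$ it defines and through its local derivative). $\Phi_r(x,d\mu):=\int_{\mathbb T}\varphi_r(x-t)\,d\mu(t)$. $\lambda(r,x)$ is the interval $[x-\lambda(r),x+\lambda(r)]\subset\mathbb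 T$ (equal to $\mathbb T$ if $\lambda(r)\ge\pi$). For a family $F_r$, $\lim_{r\to1,\ \theta\in\lambda(r,x)}F_r(\theta)=A$ means $\lim_{r\to1}\sup_{\theta\in\lambda(r,x)}|F_r(\theta)-A|=0$. *)

theory Defs
  imports "HOL-Analysis.Analysis" "HOL-Library.Periodic_Fun"
begin

text \<open>
  A function on the circle \<open>\<real>/2\<pi>\<int>\<close> is a \<open>2\<pi>\<close>-periodic function on \<open>\<real>\<close>. All functions are defined
  pointwise; in particular \<open>L\<^sup>\<infinity>\<close> consists of the bounded measurable functions and its norm is the
  supremum, not the essential supremum. The distinction matters: the measure \<open>d\<mu>\<close> may have atoms, and
  these see the value of a kernel at the single point \<open>0\<close>.
\<close>

definition L_infinity_circle :: "(real \<Rightarrow> real) \<Rightarrow> bool" where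
  "L_infinity_circle f \<longleftrightarrow>
     periodic_fun_simple f (2 * pi) \<and> f \<in> borel_measurable lebesgue \<and> bounded (range f)"

definition sup_norm :: "(real \<Rightarrow> real) \<Rightarrow> real" where
  "sup_norm f = (SUP t. \<bar>f t\<bar>)"

definition radial_majorant :: "(real \<Rightarrow> real) \<Rightarrow> real \<Rightarrow> real" where
  "radial_majorant f x = (SUP t\<in>{t. \<bar>x\<bar> \<le> \<bar>t\<bar> \<and> \<bar>t\<bar> \<le> pi}. \<bar>f t\<bar>)"

definition approximate_identity :: "(real \<Rightarrow> real \<Rightarrow> real) \<Rightarrow> bool" where
  "approximate_identity \<phi> \<longleftrightarrow>
     (\<forall>r\<in>{0<..<1}. L_infinity_circle (\<phi> r)) \<and>
     ((\<lambda>r. LINT t:{-pi..pi}|lebesgue. \<phi> r t) \<longlongrightarrow> 1) (at_left 1) \<and>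
     (\<forall>x. 0 < \<bar>x\<bar> \<and> \<bar>x\<bar> \<le> pi \<longrightarrow> ((\<lambda>r. radial_majorant (\<phi> r) x) \<longlongrightarrow> 0) (at_left 1)) \<and>
     (SUP r\<in>{0<..<1}. \<integral>\<^sup>+x\<in>{-pi..pi}. ennreal (radial_majorant (\<phi> r) x) \<partial>lebesgue) < \<infinity>"

definition regular_approximate_identity :: "(real \<Rightarrow> real \<Rightarrow> real) \<Rightarrow> bool" where
  "regular_approximate_identity \<phi> \<longleftrightarrow>
     approximate_identity \<phi> \<and>
     (\<forall>r\<in>{0<..<1}. (\<forall>t. 0 \<le> \<phi> r t) \<and> antimono_on {0..pi} (\<phi> r) \<and> mono_on {-pi..0} (\<phi> r))"

definition Pi_limsup :: "(real \<Rightarrow> real) \<Rightarrow> (real \<Rightarrow> real \<Rightarrow> real) \<Rightarrow> ereal" where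
  "Pi_limsup lam \<phi> = Limsup (at_left 1) (\<lambda>r. ereal (lam r * sup_norm (\<phi> r)))"

definition bounded_variation_on :: "(real \<Rightarrow> real) \<Rightarrow> real \<Rightarrow> real \<Rightarrow> bool" where
  "bounded_variation_on f a b \<longleftrightarrow>
     bdd_above {\<Sum>K\<in>d. \<bar>f (Sup K) - f (Inf K)\<bar> | d. d division_of {a..b}}"

text \<open>
  A function of bounded variation on a period interval is represented by its extension to \<open>\<real>\<close> with
  constant increment over each period, so that its Stieltjes measure is \<open>2\<pi>\<close>-periodic and differentiation
  makes sense at every point of the circle. The increment \<open>c\<close> is the total mass of \<open>d\<mu>\<close>; it is not
  required to vanish (Lebesgue measure corresponds to \<open>\<mu> t = t\<close>).
\<close>

definition BV_circle :: "(real \<Rightarrow> real) \<Rightarrow> bool" where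
  "BV_circle \<mu> \<longleftrightarrow> bounded_variation_on \<mu> (-pi) pi \<and> (\<exists>c. \<forall>t. \<mu> (t + 2 * pi) = \<mu> t + c)"

text \<open>
  For \<open>b < a\<close> the only division of the empty interval is the empty one, so the positive variation is \<open>0\<close>.
\<close>

definition positive_variation :: "(real \<Rightarrow> real) \<Rightarrow> real \<Rightarrow> real \<Rightarrow> real" where
  "positive_variation f a b =
     Sup {\<Sum>K\<in>d. max 0 (f (Sup K) - f (Inf K)) | d. d division_of {a..b}}"

text \<open>
  The signed measure \<open>d\<mu>\<close> with \<open>d\<mu>((a,b]) = \<mu>(b+) - \<mu>(a+)\<close> is the difference of the Stieltjes measures of
  the positive variations of \<open>\<mu>\<close> and \<open>-\<mu>\<close> (Jordan decomposition), made right-continuous as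
  \<^const>\<open>interval_measure\<close> requires. The circle is the period interval \<open>(-\<pi>,\<pi>]\<close>; the point \<open>\<pi>\<close> carries
  the jump \<open>\<mu>(\<pi>+) - \<mu>(\<pi>-)\<close>, and the mass of the interval measures outside \<open>(-\<pi>,\<pi>]\<close> is not used.
\<close>

definition positive_variation_measure :: "(real \<Rightarrow> real) \<Rightarrow> real measure" where
  "positive_variation_measure \<mu> =
     interval_measure (\<lambda>x. Lim (at_right x) (positive_variation \<mu> (-pi)))"

definition circle_stieltjes_integral :: "(real \<Rightarrow> real) \<Rightarrow> (real \<Rightarrow> real) \<Rightarrow> real" where
  "circle_stieltjes_integral \<mu> f =
     (LINT t:{-pi<..pi}|positive_variation_measure \<mu>. f t) -
     (LINT t:{-pi<..pi}|positive_variation_measure (\<lambda>t. - \<mu> t). f t)"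

definition kernel_integral :: "(real \<Rightarrow> real \<Rightarrow> real) \<Rightarrow> (real \<Rightarrow> real) \<Rightarrow> real \<Rightarrow> real \<Rightarrow> real" where
  "kernel_integral \<phi> \<mu> r x = circle_stieltjes_integral \<mu> (\<lambda>t. \<phi> r (x - t))"

text \<open>
  For periodic \<open>F r\<close> and \<open>lam r \<ge> pi\<close>, the interval below covers the whole circle. The supremum is taken
  in the extended reals, so an unbounded family has supremum \<open>\<infinity>\<close>.
\<close>

definition region_limit ::
    "(real \<Rightarrow> real \<Rightarrow> real) \<Rightarrow> (real \<Rightarrow> real) \<Rightarrow> real \<Rightarrow> real \<Rightarrow> bool" where
  "region_limit F lam x A \<longleftrightarrow>
     ((\<lambda>r. SUP \<theta>\<in>{x - lam r..x + lam r}. ereal \<bar>F r \<theta> - A\<bar>) \<longlongrightarrow> 0) (at_left 1)"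

end

theory Submission
  imports Defs
begin

text \<open>
  The signed measure \<open>d\<mu>\<close> is the difference of two finite positive measures \<open>P\<close> and \<open>N\<close>. Neither of them
  need have a derivative at \<open>x\<^sub>0\<close>, so the cancellation between them has to be kept, and the kernel has
  to be integrated against intervals, on which \<open>P - N\<close> is an increment of \<open>\<mu>\<close>. Regularity makes this
  possible: near \<open>x\<^sub>0\<close> the function \<open>t \<mapsto> \<phi>\<^sub>r(x - t)\<close> increases up to \<open>t = x\<close> and decreases afterwards, so each
  superlevel set \<open>J\<^sub>s = {t. \<phi>\<^sub>r(x - t) > s}\<close> is an interval with \<open>x\<close> in its closure. Write \<open>A = \<mu>'(x\<^sub>0)\<close>.
  Differentiability gives, for an interval \<open>J\<close> with ends \<open>u \<le> v\<close> close to \<open>x\<^sub>0\<close>,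
  \<open>\<bar>P(J) - N(J) - A \<bar>J\<bar>\<bar> \<le> \<epsilon> (\<bar>u - x\<^sub>0\<bar> + \<bar>v - x\<^sub>0\<bar>)\<close>, and for \<open>J = J\<^sub>s\<close> the right-hand side is at most
  \<open>\<epsilon> (\<bar>J\<^sub>s\<bar> + 2 \<lambda>(r))\<close>, because \<open>x\<close> is within \<open>\<lambda>(r)\<close> of \<open>x\<^sub>0\<close>.

  The layer-cake formula \<open>\<integral> f dM = \<integral> M{f > s} ds\<close>, applied to \<open>P\<close>, to \<open>N\<close> and to Lebesgue measure, integrates
  this bound over \<open>0 \<le> s \<le> \<parallel>\<phi>\<^sub>r\<parallel>\<close>. The part of \<open>\<Phi>\<^sub>r(x,d\<mu>)\<close> near \<open>x\<^sub>0\<close> therefore differs from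
  \<open>A \<integral> \<phi>\<^sub>r(x - t) dt\<close> by at most a multiple of \<open>\<epsilon> (\<integral> \<phi>\<^sub>r + \<lambda>(r) \<parallel>\<phi>\<^sub>r\<parallel>)\<close>, and this is where the hypothesis
  \<open>\<Pi>(\<lambda>,\<phi>) < \<infinity>\<close> enters. The part away from \<open>x\<^sub>0\<close> is at most \<open>\<phi>\<^sub>r\<^sup>*(\<delta>/2)\<close> times the total mass of \<open>P + N\<close>, and
  tends to \<open>0\<close>.

  The circle is cut at \<open>\<pi>\<close>, which may be the point \<open>x\<^sub>0\<close> itself. The left and the right neighbourhood of \<open>x\<^sub>0\<close>
  are therefore treated as two separate pieces of \<open>(-\<pi>,\<pi>]\<close>, ending at a representative \<open>y\<^sub>1\<close> of \<open>x\<^sub>0\<close> and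
  starting at a representative \<open>y\<^sub>2\<close>; these are equal unless \<open>y\<^sub>1 = \<pi>\<close>, when \<open>y\<^sub>2 = -\<pi>\<close>. The lemma
  \<open>signed_integral_estimate\<close> carries the layer-cake argument on one piece, and \<open>circle_kernel_estimate\<close>
  puts the pieces together for a fixed kernel.
\<close>

section \<open>Variations and the Jordan decomposition\<close>

lemma division_sum_telescope:
  fixes f :: "real \<Rightarrow> real"
  assumes "a \<le> b" "d division_of {a..b}"
  shows "(\<Sum>K\<in>d. f (Sup K) - f (Inf K)) = f b - f a"
proof -
  let ?g = "\<lambda>K::real set. if K = {} then 0 else f (Sup K) - f (Inf K)"
  interpret operative_real plus 0 ?g
    rewrites "comm_monoid_set.F (+) 0 = sum"
    by standard[1] (auto simp add: sum_def)
  have "sum ?g d = ?g {a..b}"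
    using division[of d a b] assms(2) by simp
  moreover have "sum ?g d = (\<Sum>K\<in>d. f (Sup K) - f (Inf K))"
    using assms(2) by (intro sum.cong) auto
  ultimately show ?thesis
    using assms(1) by simp
qed

text \<open>
  This turns a pointwise comparison with the increments of a function \<open>g\<close> into a bound on all division sums,
  by telescoping; it is how bounded variation over longer intervals is recognised.
\<close>

lemma division_sum_le_increment:
  fixes g :: "real \<Rightarrow> real" and F :: "real set \<Rightarrow> real"
  assumes "a \<le> b" "d division_of {a..b}"
    and dom: "\<And>x y. a \<le> x \<Longrightarrow> x \<le> y \<Longrightarrow> y \<le> b \<Longrightarrow> F {x..y} \<le> g y - g x"
  shows "sum F d \<le> g b - g a"
proof -
  have "F K \<le> g (Sup K) - g (Inf K)" if K_in: "K \<in> d" for K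
  proof -
    obtain u v where K: "K = cbox u v" "K \<noteq> {}" "K \<subseteq> {a..b}"
      using cbox_division_memE[OF K_in assms(2)] by blast
    then have "u \<le> v" "a \<le> u" "v \<le> b" by simp_all
    then show ?thesis using dom[of u v] K by simp
  qed
  then have "sum F d \<le> (\<Sum>K\<in>d. g (Sup K) - g (Inf K))"
    by (rule sum_mono)
  then show ?thesis
    using division_sum_telescope[OF assms(1,2)] by simp
qed

lemma division_append_interval:
  fixes F :: "real set \<Rightarrow> real"
  assumes "d division_of {a..x}" "a \<le> x" "x < y"
  shows "insert {x..y} d division_of {a..y}"
    and "sum F (insert {x..y} d) = sum F d + F {x..y}"
proof -
  have "d \<union> {{x..y}} division_of {a..x} \<union> {x..y}"
    using assms by (intro division_disjoint_union) (auto simp: division_of_self[of x y, simplified])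
  moreover have "{a..x} \<union> {x..y} = {a..y}" using assms by auto
  ultimately show "insert {x..y} d division_of {a..y}" by simp
  have "{x..y} \<notin> d"
  proof
    assume "{x..y} \<in> d"
    then have "{x..y} \<subseteq> {a..x}" using assms(1) by blast
    then show False using assms(3) by auto
  qed
  moreover have "finite d" using assms(1) by blast
  ultimately show "sum F (insert {x..y} d) = sum F d + F {x..y}" by simp
qed

definition division_sums :: "(real set \<Rightarrow> real) \<Rightarrow> real \<Rightarrow> real \<Rightarrow> real set" where
  "division_sums F a b = {sum F d | d. d division_of {a..b}}"

lemma division_sums_nonempty: "division_sums F a b \<noteq> {}"
  using elementary_interval[of a b] by (auto simp: division_sums_def)

text \<open>
  A division of \<open>[a,x]\<close> becomes one of \<open>[a,y]\<close> when the interval \<open>[x,y]\<close> is appended. Monotonicity of the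
  variations and the domination of increments by the total variation are the cases
  \<open>F K = max 0 (f (Sup K) - f (Inf K))\<close> and \<open>F K = \<bar>f (Sup K) - f (Inf K)\<bar>\<close>.
\<close>

lemma Sup_division_sums_superadditive:
  assumes bdd: "bdd_above (division_sums F a b)"
    and pos: "\<And>K. 0 \<le> F K" and null: "\<And>x. F {x..x} = 0"
    and "a \<le> x" "x \<le> y" "y \<le> b"
  shows "Sup (division_sums F a x) + F {x..y} \<le> Sup (division_sums F a y)"
proof -
  have ext: "\<exists>s\<in>division_sums F a v. t + F {u..v} \<le> s"
    if uv: "a \<le> u" "u \<le> v" and t: "t \<in> division_sums F a u" for u v t
  proof (cases "u = v")
    case True
    then show ?thesis using t null[of v] by (intro bexI[of _ t]) simp_all
  next
    case False
    obtain d where d: "d division_of {a..u}" "t = sum F d"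
      using t by (auto simp: division_sums_def)
    have "u < v" using uv(2) False by simp
    note append = division_append_interval[OF d(1) uv(1) this]
    have "sum F (insert {u..v} d) \<in> division_sums F a v"
      using append(1) unfolding division_sums_def by blast
    then show ?thesis
      using append(2)[of F] d(2) by (intro bexI) simp_all
  qed
  obtain B where B: "\<And>s. s \<in> division_sums F a b \<Longrightarrow> s \<le> B"
    using bdd by (auto simp: bdd_above_def)
  have bddy: "bdd_above (division_sums F a y)"
  proof (rule bdd_aboveI)
    fix t assume "t \<in> division_sums F a y"
    then obtain s where "s \<in> division_sums F a b" "t + F {y..b} \<le> s"
      using ext[of y b t] assms(4-6) by auto
    then show "t \<le> B" using B[of s] pos[of "{y..b}"] by linarith
  qed
  have "Sup (division_sums F a x) \<le> Sup (division_sums F a y) - F {x..y}"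
  proof (rule cSup_least[OF division_sums_nonempty])
    fix t assume "t \<in> division_sums F a x"
    then obtain s where "s \<in> division_sums F a y" "t + F {x..y} \<le> s"
      using ext[of x y t] assms(4-6) by auto
    then show "t \<le> Sup (division_sums F a y) - F {x..y}"
      using cSup_upper[OF _ bddy, of s] by linarith
  qed
  then show ?thesis by simp
qed

lemma Sup_division_sums_same:
  assumes "\<And>x. F {x..x} = 0"
  shows "Sup (division_sums F a a) = 0"
proof -
  have "division_sums F a a = {0}"
    using division_of_sing[of _ a] assms[of a] by (auto simp: division_sums_def)
  then show ?thesis by simp
qed

text \<open>
  Bounded variation is given on one period only, whereas the Stieltjes functions must be monotone and finite
  on the whole line. The total variation \<open>g\<^sub>0\<close> over the first period dominates the increments of \<open>\<mu>\<close> there;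
  translates of \<open>g\<^sub>0\<close>, glued one after the other, dominate them over any number of periods.
\<close>

lemma BV_circle_dominated:
  assumes "BV_circle \<mu>"
  shows "\<exists>g. \<forall>x y. -pi \<le> x \<longrightarrow> x \<le> y \<longrightarrow> y \<le> (2 * real n + 1) * pi \<longrightarrow> \<bar>\<mu> y - \<mu> x\<bar> \<le> g y - g x"
proof -
  let ?F = "\<lambda>K. \<bar>\<mu> (Sup K) - \<mu> (Inf K)\<bar>"
  obtain c where c: "\<And>t. \<mu> (t + 2 * pi) = \<mu> t + c"
    using assms by (auto simp: BV_circle_def)
  have per: "\<mu> (t + 2 * pi * real n) = \<mu> t + real n * c" for t n
  proof (induction n)
    case (Suc n)
    have "\<mu> (t + 2 * pi * real (Suc n)) = \<mu> (t + 2 * pi * real n + 2 * pi)"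
      by (simp add: algebra_simps)
    then show ?case using c[of "t + 2 * pi * real n"] Suc by (simp add: algebra_simps)
  qed simp
  define g0 where "g0 t = Sup (division_sums ?F (-pi) t)" for t
  have bdd: "bdd_above (division_sums ?F (-pi) pi)"
    using assms by (simp add: BV_circle_def bounded_variation_on_def division_sums_def)
  have g0: "\<bar>\<mu> y - \<mu> x\<bar> \<le> g0 y - g0 x" if "-pi \<le> x" "x \<le> y" "y \<le> pi" for x y
    using Sup_division_sums_superadditive[OF bdd, of x y] that by (simp add: g0_def)
  show ?thesis
  proof (induction n)
    case 0
    then show ?case using g0 by (intro exI[of _ g0]) auto
  next
    case (Suc n)
    define b where "b = (2 * real n + 1) * pi"
    define p where "p = 2 * pi * real (Suc n)"
    have bp: "b - p = -pi" "b + 2 * pi - p = pi" "-pi \<le> b"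
      by (auto simp: b_def p_def algebra_simps)
    obtain g where g: "\<And>x y. -pi \<le> x \<Longrightarrow> x \<le> y \<Longrightarrow> y \<le> b \<Longrightarrow> \<bar>\<mu> y - \<mu> x\<bar> \<le> g y - g x"
      using Suc by (auto simp: b_def)
    define h where "h t = (if t \<le> b then g t else g b + g0 (t - p) - g0 (-pi))" for t
    have next_period: "\<bar>\<mu> y - \<mu> x\<bar> \<le> g0 (y - p) - g0 (x - p)" if "b \<le> x" "x \<le> y" "y \<le> b + 2 * pi" for x y
      using g0[of "x - p" "y - p"] per[of "x - p" "Suc n"] per[of "y - p" "Suc n"] that bp
      by (simp add: p_def)
    have "\<bar>\<mu> y - \<mu> x\<bar> \<le> h y - h x" if xy: "-pi \<le> x" "x \<le> y" "y \<le> b + 2 * pi" for x y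
    proof -
      consider "y \<le> b" | "x \<le> b" "b < y" | "b < x" using xy by linarith
      then show ?thesis
      proof cases
        case 1 then show ?thesis using g xy by (simp add: h_def)
      next
        case 2
        then show ?thesis using g[of x b] next_period[of b y] xy bp by (simp add: h_def)
      next
        case 3
        then show ?thesis using next_period[of x y] xy by (simp add: h_def)
      qed
    qed
    moreover have "b + 2 * pi = (2 * real (Suc n) + 1) * pi"
      by (simp add: b_def algebra_simps)
    ultimately show ?case by (intro exI[of _ h]) auto
  qed
qed

definition up_increment :: "(real \<Rightarrow> real) \<Rightarrow> real set \<Rightarrow> real" where
  "up_increment f K = max 0 (f (Sup K) - f (Inf K))"

lemma positive_variation_eq_Sup:
  "positive_variation f a b = Sup (division_sums (up_increment f) a b)"
  by (simp add: positive_variation_def division_sums_def up_increment_def)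

lemma BV_circle_uminus: "BV_circle \<mu> \<Longrightarrow> BV_circle (\<lambda>t. - \<mu> t)"
proof -
  assume BV: "BV_circle \<mu>"
  then obtain c where "\<And>t. \<mu> (t + 2 * pi) = \<mu> t + c" by (auto simp: BV_circle_def)
  then have "\<forall>t. - \<mu> (t + 2 * pi) = - \<mu> t + - c" by simp
  moreover have "(\<lambda>K. \<bar>- \<mu> (Sup K) - - \<mu> (Inf K)\<bar>) = (\<lambda>K. \<bar>\<mu> (Sup K) - \<mu> (Inf K)\<bar>)"
    by (rule ext) arith
  then have "bounded_variation_on (\<lambda>t. - \<mu> t) (-pi) pi \<longleftrightarrow> bounded_variation_on \<mu> (-pi) pi"
    unfolding bounded_variation_on_def by (simp only:)
  ultimately show ?thesis
    using BV unfolding BV_circle_def by blast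
qed

lemma bdd_up_increment_sums:
  assumes "BV_circle \<mu>" 
  shows "bdd_above (division_sums (up_increment \<mu>) (-pi) b)"
proof (cases "-pi \<le> b")
  case False
  then show ?thesis by (auto simp: division_sums_def)
next
  case True
  obtain n :: nat where n: "b / pi \<le> real n" using real_arch_simple by blast
  then have "b \<le> real n * pi" by (simp add: field_simps)
  then have "b \<le> (2 * real n + 1) * pi"
    by (rule order_trans) (intro mult_right_mono, auto)
  note b_le = this
  obtain g where
    "\<And>x y. -pi \<le> x \<Longrightarrow> x \<le> y \<Longrightarrow> y \<le> (2 * real n + 1) * pi \<Longrightarrow> \<bar>\<mu> y - \<mu> x\<bar> \<le> g y - g x"
    using BV_circle_dominated[OF assms, of n] by blast
  then have g: "\<And>x y. -pi \<le> x \<Longrightarrow> x \<le> y \<Longrightarrow> y \<le> b \<Longrightarrow> \<bar>\<mu> y - \<mu> x\<bar> \<le> g y - g x"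
    using b_le by simp
  have "up_increment \<mu> {x..y} \<le> g y - g x" if "-pi \<le> x" "x \<le> y" "y \<le> b" for x y
    unfolding up_increment_def using g[OF that] that(2) by (simp add: abs_le_iff)
  then have "s \<le> g b - g (-pi)" if "s \<in> division_sums (up_increment \<mu>) (-pi) b" for s
    using that division_sum_le_increment[OF True, of _ "up_increment \<mu>" g] by (auto simp: division_sums_def)
  then show ?thesis by (rule bdd_aboveI)
qed

lemma mono_positive_variation:
  assumes "BV_circle \<mu>"
  shows "mono (positive_variation \<mu> (-pi))"
proof (rule monoI)
  fix x y :: real assume "x \<le> y"
  have null: "up_increment \<mu> {t..t} = 0" for t by (simp add: up_increment_def)
  have pos: "0 \<le> up_increment \<mu> K" for K by (simp add: up_increment_def)
  note sup = Sup_division_sums_superadditive[OF bdd_up_increment_sums[OF assms] pos null]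
  have low: "positive_variation \<mu> (-pi) x \<ge> 0" if "-pi \<le> x" for x
    using sup[of "-pi" x x] that pos[of "{-pi..x}"] Sup_division_sums_same[of "up_increment \<mu>" "-pi", OF null]
    by (simp add: positive_variation_eq_Sup)
  have zero: "positive_variation \<mu> (-pi) x = 0" if "x < -pi" for x
    using that by (simp add: positive_variation_def)
  show "positive_variation \<mu> (-pi) x \<le> positive_variation \<mu> (-pi) y"
  proof (cases "-pi \<le> x")
    case True
    then show ?thesis
      using sup[of x y y] \<open>x \<le> y\<close> pos[of "{x..y}"] by (simp add: positive_variation_eq_Sup)
  next
    case False
    then show ?thesis using zero[of x] zero[of y] low[of y] by force
  qed
qed

text \<open>
  For each division, the sums of the positive parts of the increments of \<open>\<mu>\<close> and of \<open>-\<mu>\<close> differ by the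
  telescoping sum \<open>\<mu> b - \<mu> (-\<pi>)\<close>, which is the same for all divisions, so the suprema differ by it too.
\<close>

lemma jordan_decomposition:
  assumes "BV_circle \<mu>" "-pi \<le> b"
  shows "positive_variation \<mu> (-pi) b - positive_variation (\<lambda>t. - \<mu> t) (-pi) b = \<mu> b - \<mu> (-pi)"
proof -
  let ?P = "division_sums (up_increment \<mu>) (-pi) b"
  let ?N = "division_sums (up_increment (\<lambda>t. - \<mu> t)) (-pi) b"
  have "sum (up_increment \<mu>) d = sum (up_increment (\<lambda>t. - \<mu> t)) d + (\<mu> b - \<mu> (-pi))"
    if "d division_of {-pi..b}" for d
  proof -
    have "(\<Sum>K\<in>d. \<mu> (Sup K) - \<mu> (Inf K)) = sum (\<lambda>K. up_increment \<mu> K - up_increment (\<lambda>t. - \<mu> t) K) d"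
      by (intro sum.cong) (auto simp: up_increment_def max_def)
    then show ?thesis
      using division_sum_telescope[OF assms(2) that, of \<mu>] by (simp add: sum_subtractf)
  qed
  note eq = this
  have "Sup ?P \<le> Sup ?N + (\<mu> b - \<mu> (-pi))"
  proof (rule cSup_least[OF division_sums_nonempty])
    fix s assume "s \<in> ?P"
    then obtain d where "d division_of {-pi..b}" "s = sum (up_increment \<mu>) d"
      by (auto simp: division_sums_def)
    moreover from this have "sum (up_increment (\<lambda>t. - \<mu> t)) d \<le> Sup ?N"
      using bdd_up_increment_sums[OF BV_circle_uminus[OF assms(1)]]
      by (intro cSup_upper) (auto simp: division_sums_def)
    ultimately show "s \<le> Sup ?N + (\<mu> b - \<mu> (-pi))" using eq by simp
  qed
  moreover have "Sup ?N \<le> Sup ?P - (\<mu> b - \<mu> (-pi))"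
  proof (rule cSup_least[OF division_sums_nonempty])
    fix s assume "s \<in> ?N"
    then obtain d where "d division_of {-pi..b}" "s = sum (up_increment (\<lambda>t. - \<mu> t)) d"
      by (auto simp: division_sums_def)
    moreover from this have "sum (up_increment \<mu>) d \<le> Sup ?P"
      using bdd_up_increment_sums[OF assms(1)]
      by (intro cSup_upper) (auto simp: division_sums_def)
    ultimately show "s \<le> Sup ?P - (\<mu> b - \<mu> (-pi))" using eq[of d] by simp
  qed
  ultimately show ?thesis
    by (simp add: positive_variation_eq_Sup)
qed

section \<open>The Stieltjes measures of the variations\<close>

lemma tendsto_Lim_at_right_mono:
  fixes V :: "real \<Rightarrow> real"
  assumes "mono V"
  shows "(V \<longlongrightarrow> Lim (at_right x) V) (at_right x)"
proof -
  have "(V \<longlongrightarrow> Inf (V ` ({x<..} \<inter> UNIV))) (at x within ({x<..} \<inter> UNIV))"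
    by (rule Lim_right_bound[where K = "V x"]) (auto intro: monoD[OF assms])
  then show ?thesis
    by (simp add: tendsto_Lim)
qed

lemma Lim_at_right_mono_bounds:
  fixes V :: "real \<Rightarrow> real"
  assumes "mono V"
  shows "V x \<le> Lim (at_right x) V" and "x < y \<Longrightarrow> Lim (at_right x) V \<le> V y"
proof -
  show "V x \<le> Lim (at_right x) V"
    by (rule tendsto_lowerbound[OF tendsto_Lim_at_right_mono[OF assms]])
       (auto simp: eventually_at_filter intro!: always_eventually monoD[OF assms])
  show "Lim (at_right x) V \<le> V y" if "x < y"
    by (rule tendsto_upperbound[OF tendsto_Lim_at_right_mono[OF assms]])
       (auto intro!: eventually_at_rightI[OF _ that] monoD[OF assms])
qed

lemma Lim_at_right_mono_right_continuous:
  fixes V :: "real \<Rightarrow> real"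
  assumes "mono V"
  shows "mono (\<lambda>x. Lim (at_right x) V)"
    and "continuous (at_right x) (\<lambda>x. Lim (at_right x) V)"
proof -
  let ?R = "\<lambda>x. Lim (at_right x) V"
  show mono: "mono ?R"
  proof (rule monoI)
    fix x y :: real assume "x \<le> y"
    then consider "x = y" | "x < y" by linarith
    then show "?R x \<le> ?R y"
      using Lim_at_right_mono_bounds[OF assms] by cases (auto intro: order_trans)
  qed
  have "((\<lambda>z. ?R z) \<longlongrightarrow> ?R x) (at_right x)"
  proof (rule order_tendstoI)
    fix a assume "a < ?R x"
    then have "a < ?R z" if "x < z" for z
      using monoD[OF mono, of x z] that by linarith
    then show "\<forall>\<^sub>F z in at_right x. a < ?R z"
      by (auto simp: eventually_at_filter)
  next
    fix a assume "?R x < a"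
    then have "\<forall>\<^sub>F z in at_right x. V z < a"
      by (rule order_tendstoD(2)[OF tendsto_Lim_at_right_mono[OF assms]])
    then obtain b where b: "b > x" "\<And>z. x < z \<Longrightarrow> z < b \<Longrightarrow> V z < a"
      by (auto simp: eventually_at_right_field)
    have "?R z < a" if "x < z" "z < b" for z
    proof -
      have "?R z \<le> V ((z + b) / 2)" 
        using that by (intro Lim_at_right_mono_bounds[OF assms]) auto
      also have "\<dots> < a" using b that by auto
      finally show ?thesis .
    qed
    then show "\<forall>\<^sub>F z in at_right x. ?R z < a"
      using b(1) by (auto simp: eventually_at_right_field)
  qed
  then show "continuous (at_right x) ?R"
    by (simp add: continuous_within)
qed

lemma sets_positive_variation_measure [simp, measurable_cong]:
  "sets (positive_variation_measure \<mu>) = sets borel"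
  by (simp add: positive_variation_measure_def)

lemma space_positive_variation_measure [simp]: "space (positive_variation_measure \<mu>) = UNIV"
  by (simp add: positive_variation_measure_def)

text \<open>
  The right limits of a monotone function form a monotone right-continuous function, so the measures used to
  define \<open>d\<mu>\<close> are Stieltjes measures in the proper sense.
\<close>

lemma
  assumes "BV_circle \<mu>"
  shows sigma_finite_positive_variation_measure:
      "sigma_finite_measure (positive_variation_measure \<mu>)"
    and emeasure_positive_variation_measure_Ioc:
      "emeasure (positive_variation_measure \<mu>) {a<..b} < \<infinity>"
    and measure_positive_variation_measure_Ioc:
      "a \<le> b \<Longrightarrow> measure (positive_variation_measure \<mu>) {a<..b} =
        Lim (at_right b) (positive_variation \<mu> (-pi)) - Lim (at_right a) (positive_variation \<mu> (-pi))"
proof -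
  let ?R = "\<lambda>x. Lim (at_right x) (positive_variation \<mu> (-pi))"
  note R = Lim_at_right_mono_right_continuous[OF mono_positive_variation[OF assms]]
  have mono: "?R x \<le> ?R y" if "x \<le> y" for x y using R(1) that by (rule monoD)
  show "sigma_finite_measure (positive_variation_measure \<mu>)"
    unfolding positive_variation_measure_def by (rule sigma_finite_interval_measure[OF mono R(2)])
  show "emeasure (positive_variation_measure \<mu>) {a<..b} < \<infinity>"
    unfolding positive_variation_measure_def by (subst emeasure_interval_measure_Ioc_eq[OF mono R(2)]) auto
  show "a \<le> b \<Longrightarrow> measure (positive_variation_measure \<mu>) {a<..b} = ?R b - ?R a"
    unfolding positive_variation_measure_def by (rule measure_interval_measure_Ioc[OF _ mono R(2)])
qed

text \<open>
  Let \<open>E(t) = \<mu>(t+) - \<mu>(y) - A (t - y)\<close>. Then \<open>P(a,b] - N(a,b] - A (b - a) = E(b) - E(a)\<close> for the two variation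
  measures \<open>P\<close> and \<open>N\<close>, and \<open>\<bar>E(t)\<bar> \<le> e \<bar>t - y\<bar>\<close> because the defining inequality of the derivative survives the
  passage to right limits. The bound \<open>-\<pi> \<le> a\<close> is there because the Jordan decomposition starts at \<open>-\<pi>\<close>.
\<close>

lemma jordan_measure_derivative:
  assumes BV: "BV_circle \<mu>" and D: "(\<mu> has_real_derivative A) (at y)" and e: "0 < e"
  shows "\<exists>\<rho>>0. \<forall>a b. -pi \<le> a \<longrightarrow> a \<le> b \<longrightarrow> \<bar>a - y\<bar> < \<rho> \<longrightarrow> \<bar>b - y\<bar> < \<rho> \<longrightarrow>
    \<bar>measure (positive_variation_measure \<mu>) {a<..b} - measure (positive_variation_measure (\<lambda>t. - \<mu> t)) {a<..b}
       - A * (b - a)\<bar> \<le> e * (\<bar>a - y\<bar> + \<bar>b - y\<bar>)"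
proof -
  let ?V = "positive_variation \<mu> (-pi)" and ?W = "positive_variation (\<lambda>t. - \<mu> t) (-pi)"
  note BV' = BV_circle_uminus[OF BV]
  have "(\<mu> has_derivative (*) A) (at y)"
    using D by (simp add: has_field_derivative_def)
  then obtain \<rho> where \<rho>: "\<rho> > 0" and
    bound: "\<And>t. \<bar>t - y\<bar> < \<rho> \<Longrightarrow> \<bar>\<mu> t - \<mu> y - A * (t - y)\<bar> \<le> e * \<bar>t - y\<bar>"
    using e unfolding has_derivative_at_alt by (auto simp: real_norm_def)
  define E where "E t = Lim (at_right t) ?V - Lim (at_right t) ?W + \<mu> (-pi) - \<mu> y - A * (t - y)" for t
  have E: "\<bar>E t\<bar> \<le> e * \<bar>t - y\<bar>" if t: "-pi \<le> t" "\<bar>t - y\<bar> < \<rho>" for t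
  proof -
    have "((\<lambda>s. \<bar>?V s - ?W s + \<mu> (-pi) - \<mu> y - A * (s - y)\<bar>) \<longlongrightarrow> \<bar>E t\<bar>) (at_right t)"
      unfolding E_def
      by (intro tendsto_intros tendsto_Lim_at_right_mono mono_positive_variation BV BV')
    moreover have "((\<lambda>s. e * \<bar>s - y\<bar>) \<longlongrightarrow> e * \<bar>t - y\<bar>) (at_right t)"
      by (intro tendsto_intros)
    moreover have "\<forall>\<^sub>F s in at_right t. \<bar>?V s - ?W s + \<mu> (-pi) - \<mu> y - A * (s - y)\<bar> \<le> e * \<bar>s - y\<bar>"
    proof (rule eventually_at_rightI)
      show "t < y + \<rho>" using t(2) by linarith
      fix s assume "s \<in> {t<..<y + \<rho>}"
      then have "-pi \<le> s" "\<bar>s - y\<bar> < \<rho>" using t by auto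
      then show "\<bar>?V s - ?W s + \<mu> (-pi) - \<mu> y - A * (s - y)\<bar> \<le> e * \<bar>s - y\<bar>"
        using bound[of s] jordan_decomposition[OF BV, of s] by simp
    qed
    ultimately show ?thesis
      by (intro tendsto_le[of "at_right t"]) auto
  qed
  show ?thesis
  proof (intro exI[of _ \<rho>] conjI allI impI \<rho>)
    fix a b assume ab: "-pi \<le> a" "a \<le> b" "\<bar>a - y\<bar> < \<rho>" "\<bar>b - y\<bar> < \<rho>"
    have "measure (positive_variation_measure \<mu>) {a<..b} - measure (positive_variation_measure (\<lambda>t. - \<mu> t)) {a<..b}
       - A * (b - a) = E b - E a"
      unfolding measure_positive_variation_measure_Ioc[OF BV ab(2)]
        measure_positive_variation_measure_Ioc[OF BV' ab(2)] E_def by (simp add: algebra_simps)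
    then show "\<bar>measure (positive_variation_measure \<mu>) {a<..b} - measure (positive_variation_measure (\<lambda>t. - \<mu> t)) {a<..b}
       - A * (b - a)\<bar> \<le> e * (\<bar>a - y\<bar> + \<bar>b - y\<bar>)"
      using E[of a] E[of b] ab by (simp add: distrib_left)
  qed
qed

section \<open>Integrals of unimodal functions against a difference of measures\<close>

text \<open>
  Fubini's theorem for the indicator of \<open>{(t,s). t \<in> S \<and> 0 \<le> s < f t}\<close>.
\<close>

lemma layer_cake:
  fixes f :: "real \<Rightarrow> real"
  assumes "sigma_finite_measure M" and M[measurable_cong]: "sets M = sets borel"
    and S[measurable]: "S \<in> sets borel" and fin: "emeasure M S < \<infinity>"
    and f[measurable]: "f \<in> borel_measurable borel"
    and bnd: "\<And>t. t \<in> S \<Longrightarrow> 0 \<le> f t \<and> f t \<le> B"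
  shows "(LINT t:S|M. f t) = (LINT s:{0..B}|lborel. measure M {t\<in>S. s < f t})"
    and "set_integrable lborel {0..B} (\<lambda>s. measure M {t\<in>S. s < f t})"
proof -
  interpret M: sigma_finite_measure M by fact
  interpret pair_sigma_finite M lborel ..
  have space: "space M = UNIV" using sets_eq_imp_space_eq[OF M] by simp
  let ?h = "\<lambda>t s. indicator S t * indicator {0..B} s * indicator {s. s < f t} s :: real"
  have int: "integrable (M \<Otimes>\<^sub>M lborel) (case_prod ?h)"
  proof (rule integrableI_bounded_set[where A = "S \<times> {0..B}" and B = 1])
    have "emeasure (M \<Otimes>\<^sub>M lborel) (S \<times> {0..B}) = emeasure M S * emeasure lborel {0..B}"
      by (subst lborel.emeasure_pair_measure_Times) auto
    also have "\<dots> < \<infinity>" using fin by (simp add: ennreal_mult_less_top emeasure_lborel_Icc_eq)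
    finally show "emeasure (M \<Otimes>\<^sub>M lborel) (S \<times> {0..B}) < \<infinity>" .
  qed (auto simp: indicator_def)
  have inner_t: "(\<integral>t. ?h t s \<partial>M) = indicator {0..B} s * measure M {t\<in>S. s < f t}" for s
  proof -
    have "(\<integral>t. ?h t s \<partial>M) = (\<integral>t. indicator {0..B} s * indicator {t\<in>S. s < f t} t \<partial>M)"
      by (intro Bochner_Integration.integral_cong) (auto simp: indicator_def)
    then show ?thesis by (simp add: space)
  qed
  have inner_s: "(\<integral>s. ?h t s \<partial>lborel) = indicator S t * f t" for t
  proof -
    have "(\<integral>s. ?h t s \<partial>lborel) = (\<integral>s. indicator S t * indicator {0..<f t} s \<partial>lborel)"
      using bnd[of t] by (intro Bochner_Integration.integral_cong) (auto simp: indicator_def)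
    then show ?thesis using bnd[of t] by (cases "t \<in> S") auto
  qed
  show "set_integrable lborel {0..B} (\<lambda>s. measure M {t\<in>S. s < f t})"
    using integrable_snd[OF int] by (simp add: inner_t set_integrable_def)
  show "(LINT t:S|M. f t) = (LINT s:{0..B}|lborel. measure M {t\<in>S. s < f t})"
    using Fubini_integral[OF int] by (simp add: inner_t inner_s set_lebesgue_integral_def)
qed

text \<open>
  Superlevel sets of a unimodal function may contain either, both or none of their end points. Approximating by
  half-open intervals, whose mass is an increment of the distribution function, treats all cases at once.
  Staying above \<open>l\<close> and below \<open>r\<close> keeps the approximating intervals where the increments are under control.
\<close>

lemma real_interval_limit_of_Ioc:
  fixes J :: "real set"
  assumes J: "is_interval J" "J \<noteq> {}" "J \<subseteq> {l<..r}"
  obtains a b :: "nat \<Rightarrow> real"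
  where "\<And>n. l \<le> a n" "\<And>n. a n \<le> b n" "\<And>n. b n \<le> r"
    and "a \<longlonglongrightarrow> Inf J" "b \<longlonglongrightarrow> Sup J"
    and "\<And>x. (\<lambda>n. indicator {a n<..b n} x :: real) \<longlonglongrightarrow> indicator J x"
proof -
  define u v where "u = Inf J" and "v = Sup J"
  have bdd: "bdd_below J" "bdd_above J" using J(3) by (meson bdd_below.I2 bdd_below_Ioc bdd_below_mono, meson bdd_above_Ioc bdd_above_mono)
  have J_sub: "u \<le> t" "t \<le> v" if "t \<in> J" for t
    using that bdd by (auto simp: u_def v_def cInf_lower cSup_upper)
  have J_sup: "t \<in> J" if t: "u < t" "t < v" for t
  proof -
    obtain x y where "x \<in> J" "x < t" "y \<in> J" "t < y"
      using t cInf_less_iff[OF J(2) bdd(1), of t] less_cSup_iff[OF J(2) bdd(2), of t]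
      unfolding u_def v_def by blast
    then show ?thesis using J(1) by (meson is_interval_1 less_imp_le)
  qed
  have uv: "l \<le> u" "u \<le> v" "v \<le> r"
    using J bdd J_sub unfolding u_def v_def by (force intro: cInf_greatest cSup_least cInf_le_cSup)+
  define w :: "nat \<Rightarrow> real" where "w n = inverse (real (Suc n))" for n
  have w: "w \<longlonglongrightarrow> 0" "\<And>n. w n > 0"
    unfolding w_def by (rule LIMSEQ_inverse_real_of_nat) simp
  define a where "a n = (if u \<in> J then max l (u - w n) else u)" for n
  define b where "b n = (if v \<in> J then v else max u (v - w n))" for n
  show ?thesis
  proof (rule that)
    show "l \<le> a n" "a n \<le> b n" "b n \<le> r" for n
      using uv w(2)[of n] by (auto simp: a_def b_def)
    have "(\<lambda>n. max l (u - w n)) \<longlonglongrightarrow> max l (u - 0)" "(\<lambda>n. max u (v - w n)) \<longlonglongrightarrow> max u (v - 0)"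
      by (intro tendsto_intros w)+
    then show a_lim: "a \<longlonglongrightarrow> Inf J" and b_lim: "b \<longlonglongrightarrow> Sup J"
      using uv unfolding a_def[abs_def] b_def[abs_def] u_def[symmetric] v_def[symmetric]
      by (cases "u \<in> J"; cases "v \<in> J"; simp add: max_absorb2)+
    \<comment> \<open>Eventually \<open>{a n<..b n}\<close> decides membership of each point just as \<open>J\<close> does, at the end points too.\<close>
    have left: "\<forall>\<^sub>F n in sequentially. a n < x \<longleftrightarrow> u < x \<or> u = x \<and> u \<in> J" for x
    proof -
      consider "u < x" | "u = x" | "x < u" by linarith
      then show ?thesis
      proof cases
        case 1
        then show ?thesis using order_tendstoD(2)[OF a_lim, of x] by (auto simp: u_def elim!: eventually_mono)
      next
        case 2
        then show ?thesis using w(2) J(3) by (auto simp: a_def intro!: always_eventually)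
      next
        case 3
        then show ?thesis using order_tendstoD(1)[OF a_lim, of x] by (auto simp: u_def elim!: eventually_mono)
      qed
    qed
    have right: "\<forall>\<^sub>F n in sequentially. x \<le> b n \<longleftrightarrow> x < v \<or> x = v \<and> v \<in> J" if "u < x \<or> u = x \<and> u \<in> J" for x
    proof -
      consider "v < x" | "v = x" | "x < v" by linarith
      then show ?thesis
      proof cases
        case 1
        then show ?thesis using order_tendstoD(2)[OF b_lim, of x] by (auto simp: v_def elim!: eventually_mono)
      next
        case 2
        then show ?thesis using w(2) that by (auto simp: b_def not_le intro!: always_eventually)
      next
        case 3
        then show ?thesis using order_tendstoD(1)[OF b_lim, of x] by (auto simp: v_def elim!: eventually_mono)
      qed
    qed
    show "(\<lambda>n. indicator {a n<..b n} x :: real) \<longlonglongrightarrow> indicator J x" for x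
    proof (rule tendsto_eventually)
      define L R where "L \<longleftrightarrow> u < x \<or> u = x \<and> u \<in> J" and "R \<longleftrightarrow> x < v \<or> x = v \<and> v \<in> J"
      have mem: "x \<in> J \<longleftrightarrow> L \<and> R"
        unfolding L_def R_def using J_sub[of x] J_sup[of x] by force
      have "\<forall>\<^sub>F n in sequentially. a n < x \<and> x \<le> b n \<longleftrightarrow> L \<and> R"
      proof (cases L)
        case True
        then show ?thesis
          using eventually_conj[OF left[of x, folded L_def] right[of x, folded L_def R_def, OF True]]
          by (auto elim!: eventually_mono)
      next
        case False
        then show ?thesis
          using left[of x, folded L_def] by (auto elim!: eventually_mono)
      qed
      then show "\<forall>\<^sub>F n in sequentially. indicator {a n<..b n} x = (indicator J x :: real)"
        by (rule eventually_mono) (simp add: indicator_def mem)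
    qed
  qed
qed

lemma measure_tendsto_of_indicator:
  fixes I :: "nat \<Rightarrow> real set"
  assumes M: "sets M = sets borel" and fin: "emeasure M {l<..r} < \<infinity>"
    and I: "\<And>n. I n \<in> sets borel" "\<And>n. I n \<subseteq> {l<..r}"
    and J: "J \<in> sets borel"
    and lim: "\<And>x. (\<lambda>n. indicator (I n) x :: real) \<longlonglongrightarrow> indicator J x"
  shows "(\<lambda>n. measure M (I n)) \<longlonglongrightarrow> measure M J"
proof -
  have [simp]: "space M = UNIV" using sets_eq_imp_space_eq[OF M] by simp
  have "(\<lambda>n. \<integral>x. indicator (I n) x \<partial>M) \<longlonglongrightarrow> (\<integral>x. indicator J x \<partial>M :: real)"
  proof (rule integral_dominated_convergence[where w = "indicator {l<..r}"])
    show "integrable M (indicator {l<..r} :: real \<Rightarrow> real)"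
      using fin M by simp
    show "AE x in M. norm (indicator (I n) x :: real) \<le> indicator {l<..r} x" for n
      using I(2)[of n] by (intro AE_I2) (auto simp: indicator_def)
    show "indicator (I n) \<in> borel_measurable M" "indicator J \<in> borel_measurable M" for n
      by (rule borel_measurable_indicator, simp add: M I J)+
  qed (use lim in auto)
  then show ?thesis by simp
qed

lemma signed_interval_estimate:
  assumes P: "sets P = sets borel" "emeasure P {l<..r} < \<infinity>"
    and N: "sets N = sets borel" "emeasure N {l<..r} < \<infinity>"
    and Ioc: "\<And>a b. l \<le> a \<Longrightarrow> a \<le> b \<Longrightarrow> b \<le> r \<Longrightarrow>
      \<bar>measure P {a<..b} - measure N {a<..b} - A * (b - a)\<bar> \<le> e * (\<bar>a - y\<bar> + \<bar>b - y\<bar>)"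
    and J: "is_interval J" "J \<noteq> {}" "J \<subseteq> {l<..r}"
  shows "\<bar>measure P J - measure N J - A * measure lborel J\<bar> \<le> e * (\<bar>Inf J - y\<bar> + \<bar>Sup J - y\<bar>)"
    and "measure lborel J = Sup J - Inf J"
proof -
  have J_borel: "J \<in> sets borel"
    using J(1) by (rule real_interval_borel_measurable)
  obtain a b :: "nat \<Rightarrow> real" where ab: "\<And>n. l \<le> a n" "\<And>n. a n \<le> b n" "\<And>n. b n \<le> r"
    and lims: "a \<longlonglongrightarrow> Inf J" "b \<longlonglongrightarrow> Sup J"
    and ind: "\<And>x. (\<lambda>n. indicator {a n<..b n} x :: real) \<longlonglongrightarrow> indicator J x"
    using real_interval_limit_of_Ioc[OF J] by blast
  have lim: "(\<lambda>n. measure M {a n<..b n}) \<longlonglongrightarrow> measure M J"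
    if "sets M = sets borel" "emeasure M {l<..r} < \<infinity>" for M
  proof (rule measure_tendsto_of_indicator[OF that])
    show "{a n<..b n} \<subseteq> {l<..r}" for n
      using ab(1,3)[of n] by auto
  qed (use J_borel ind in auto)
  have "(\<lambda>n. b n - a n) \<longlonglongrightarrow> measure lborel J"
    using lim[of lborel] ab(2) by (cases "l \<le> r") (simp_all add: measure_lborel_Ioc)
  moreover have len: "(\<lambda>n. b n - a n) \<longlonglongrightarrow> Sup J - Inf J"
    by (intro tendsto_intros lims)
  ultimately show *: "measure lborel J = Sup J - Inf J"
    by (rule LIMSEQ_unique)
  show "\<bar>measure P J - measure N J - A * measure lborel J\<bar> \<le> e * (\<bar>Inf J - y\<bar> + \<bar>Sup J - y\<bar>)"
  proof (rule LIMSEQ_le)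
    show "(\<lambda>n. \<bar>measure P {a n<..b n} - measure N {a n<..b n} - A * (b n - a n)\<bar>)
        \<longlonglongrightarrow> \<bar>measure P J - measure N J - A * measure lborel J\<bar>"
      unfolding * by (intro tendsto_intros lims lim P N)
    show "(\<lambda>n. e * (\<bar>a n - y\<bar> + \<bar>b n - y\<bar>)) \<longlonglongrightarrow> e * (\<bar>Inf J - y\<bar> + \<bar>Sup J - y\<bar>)"
      by (intro tendsto_intros lims)
  qed (use Ioc ab in blast)
qed

text \<open>
  The layer-cake argument on one piece \<open>S\<close>. The inequality assumed for the superlevel sets expresses that each of
  them is an interval at distance at most \<open>d\<close> from \<open>y\<close>. Integrating over the levels turns the lengths into
  \<open>\<integral>\<^sub>S f\<close> and the constant \<open>2 d\<close> into \<open>2 d B\<close>, since there are no levels above \<open>B\<close>.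
\<close>

lemma signed_integral_estimate:
  assumes P: "sigma_finite_measure P" "sets P = sets borel" "emeasure P {l<..r} < \<infinity>"
    and N: "sigma_finite_measure N" "sets N = sets borel" "emeasure N {l<..r} < \<infinity>"
    and Ioc: "\<And>a b. l \<le> a \<Longrightarrow> a \<le> b \<Longrightarrow> b \<le> r \<Longrightarrow>
      \<bar>measure P {a<..b} - measure N {a<..b} - A * (b - a)\<bar> \<le> e * (\<bar>a - y\<bar> + \<bar>b - y\<bar>)"
    and S: "S \<in> sets borel" "S \<subseteq> {l<..r}" and e: "0 \<le> e" and d: "0 \<le> d"
    and f: "f \<in> borel_measurable borel" "\<And>t. t \<in> S \<Longrightarrow> 0 \<le> f t \<and> f t \<le> B" and B: "0 \<le> B"
    and level: "\<And>s. {t\<in>S. s < f t} \<noteq> {} \<Longrightarrow> is_interval {t\<in>S. s < f t} \<and>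
      \<bar>Inf {t\<in>S. s < f t} - y\<bar> + \<bar>Sup {t\<in>S. s < f t} - y\<bar> \<le>
        (Sup {t\<in>S. s < f t} - Inf {t\<in>S. s < f t}) + 2 * d"
  shows "\<bar>(LINT t:S|P. f t) - (LINT t:S|N. f t) - A * (LINT t:S|lborel. f t)\<bar>
    \<le> e * ((LINT t:S|lborel. f t) + 2 * d * B)"
proof -
  define J where "J s = {t\<in>S. s < f t}" for s
  have fin: "emeasure M S < \<infinity>" if "sets M = sets borel" "emeasure M {l<..r} < \<infinity>" for M
  proof -
    have "emeasure M S \<le> emeasure M {l<..r}"
      using S that by (intro emeasure_mono) auto
    then show ?thesis using that(2) by (rule le_less_trans)
  qed
  have lb: "emeasure lborel {l<..r} < \<infinity>" by (cases "l \<le> r") simp_all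
  have cake: "(LINT t:S|M. f t) = (LINT s:{0..B}|lborel. measure M (J s))"
      "set_integrable lborel {0..B} (\<lambda>s. measure M (J s))"
    if "sigma_finite_measure M" "sets M = sets borel" "emeasure M {l<..r} < \<infinity>" for M
    using layer_cake[OF that(1,2) S(1) fin[OF that(2,3)] f] unfolding J_def by auto
  note cakeP = cake[OF P] and cakeN = cake[OF N]
  have cakeL: "(LINT t:S|lborel. f t) = (LINT s:{0..B}|lborel. measure lborel (J s))"
      "set_integrable lborel {0..B} (\<lambda>s. measure lborel (J s))"
    using cake[OF lborel.sigma_finite_measure_axioms sets_lborel lb] .
  have bound: "\<bar>measure P (J s) - measure N (J s) - A * measure lborel (J s)\<bar>
      \<le> e * (measure lborel (J s) + 2 * d)" for s
  proof (cases "J s = {}")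
    case True
    then show ?thesis using e d by simp
  next
    case False
    have sub: "J s \<subseteq> {l<..r}" using S(2) by (auto simp: J_def)
    have int: "is_interval (J s)"
      and diam: "\<bar>Inf (J s) - y\<bar> + \<bar>Sup (J s) - y\<bar> \<le> (Sup (J s) - Inf (J s)) + 2 * d"
      using level[of s] False by (auto simp: J_def)
    have "\<bar>measure P (J s) - measure N (J s) - A * measure lborel (J s)\<bar>
        \<le> e * (\<bar>Inf (J s) - y\<bar> + \<bar>Sup (J s) - y\<bar>)"
      and len: "measure lborel (J s) = Sup (J s) - Inf (J s)"
      by (rule signed_interval_estimate[OF P(2,3) N(2,3) _ int False sub]; rule Ioc; assumption)+
    then show ?thesis
      using mult_left_mono[OF diam e] unfolding len by linarith
  qed
  let ?D = "\<lambda>s. measure P (J s) - measure N (J s) - A * measure lborel (J s)"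
  have intD: "set_integrable lborel {0..B} ?D"
    using cakeP(2) cakeN(2) cakeL(2) by (intro set_integral_diff set_integrable_mult_right) auto
  have const: "set_integrable lborel {0..B} (\<lambda>s. 2 * d)"
    by (rule borel_integrable_atLeastAtMost') simp
  have intE: "set_integrable lborel {0..B} (\<lambda>s. e * (measure lborel (J s) + 2 * d))"
    by (intro set_integrable_mult_right set_integral_add(1) cakeL(2) const)
  have "(LINT t:S|P. f t) - (LINT t:S|N. f t) - A * (LINT t:S|lborel. f t) = (LINT s:{0..B}|lborel. ?D s)"
    using cakeP cakeN cakeL by (simp add: set_integral_diff set_integrable_mult_right)
  also have "\<bar>\<dots>\<bar> \<le> (LINT s:{0..B}|lborel. \<bar>?D s\<bar>)"
    unfolding set_lebesgue_integral_def
    by (rule order_trans[OF integral_abs_bound]) (simp add: abs_mult)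
  also have "\<dots> \<le> (LINT s:{0..B}|lborel. e * (measure lborel (J s) + 2 * d))"
    using bound intE set_integrable_abs[OF intD] by (intro set_integral_mono) auto
  also have "\<dots> = e * ((LINT t:S|lborel. f t) + 2 * d * B)"
  proof -
    have "(LINT s:{0..B}|lborel. measure lborel (J s) + 2 * d) =
        (LINT s:{0..B}|lborel. measure lborel (J s)) + (LINT s:{0..B}|lborel. 2 * d)"
      by (intro set_integral_add(2) cakeL(2) const)
    also have "(LINT s:{0..B}|lborel. 2 * d) = 2 * d * B"
      using B by (simp add: set_lebesgue_integral_def)
    finally show ?thesis unfolding cakeL(1) by simp
  qed
  finally show ?thesis .
qed

lemma unimodal_superlevel_interval:
  fixes f :: "real \<Rightarrow> real"
  assumes "is_interval S" "mono_on (S \<inter> {..c}) f" "antimono_on (S \<inter> {c..}) f"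
  shows "is_interval {t\<in>S. s < f t}"
  unfolding is_interval_1
proof (intro ballI allI impI)
  fix a b x assume ab: "a \<in> {t\<in>S. s < f t}" "b \<in> {t\<in>S. s < f t}" and x: "a \<le> x \<and> x \<le> b"
  then have "x \<in> S" using assms(1) unfolding is_interval_1 by blast
  moreover have "s < f x"
  proof (cases "x \<le> c")
    case True
    then have "f a \<le> f x"
      using ab x \<open>x \<in> S\<close> by (intro mono_onD[OF assms(2)]) auto
    then show ?thesis using ab by simp
  next
    case False
    then have "f b \<le> f x"
      using ab x \<open>x \<in> S\<close> by (intro monotone_onD[OF assms(3)]) auto
    then show ?thesis using ab by simp
  qed
  ultimately show "x \<in> {t\<in>S. s < f t}" by simp
qed

text \<open>
  If \<open>f\<close> increases up to \<open>c\<close>, a nonempty superlevel set in \<open>(l,y]\<close> reaches up to \<open>c\<close>, or to \<open>y\<close> if \<open>c\<close> lies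
  beyond it. In both cases it comes within \<open>d\<close> of \<open>y\<close>.
\<close>

lemma unimodal_superlevel_left:
  fixes f :: "real \<Rightarrow> real"
  assumes mono: "mono_on ({l<..y} \<inter> {..c}) f" and ne: "{t\<in>{l<..y}. s < f t} \<noteq> {}" and c: "\<bar>c - y\<bar> \<le> d"
  defines "J \<equiv> {t\<in>{l<..y}. s < f t}"
  shows "\<bar>Inf J - y\<bar> + \<bar>Sup J - y\<bar> \<le> (Sup J - Inf J) + 2 * d"
proof -
  obtain t where t: "t \<in> J" using ne by (auto simp: J_def)
  have bdd: "bdd_above J" "bdd_below J" by (auto simp: J_def intro: bdd_aboveI[of _ y] bdd_belowI[of _ l])
  have "Sup J \<le> y" using t by (intro cSup_least) (auto simp: J_def)
  moreover have "Inf J \<le> t" "t \<le> Sup J" using bdd t by (auto intro: cInf_lower cSup_upper)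
  moreover have "y - d \<le> Sup J"
  proof (cases "c \<le> t")
    case True then show ?thesis using c \<open>t \<le> Sup J\<close> by linarith
  next
    case False
    then have "f t \<le> f (min c y)"
      using t by (intro mono_onD[OF mono]) (auto simp: J_def)
    then have "min c y \<in> J" using t False by (auto simp: J_def)
    then have "min c y \<le> Sup J" using bdd by (auto intro: cSup_upper)
    then show ?thesis using c by linarith
  qed
  ultimately show ?thesis by linarith
qed

text \<open>
  The mirror image, except that the end point \<open>y\<close> is excluded and \<open>max c y\<close> need not belong to the piece. A
  superlevel set without a point in \<open>(y,y + d]\<close> would contain all points between \<open>y + d\<close> and one of its points,
  which suffices to bound its infimum.
\<close>

lemma unimodal_superlevel_right:
  fixes f :: "real \<Rightarrow> real"
  assumes anti: "antimono_on ({y<..<r} \<inter> {c..}) f" and ne: "{t\<in>{y<..<r}. s < f t} \<noteq> {}" and c: "\<bar>c - y\<bar> \<le> d"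
  defines "J \<equiv> {t\<in>{y<..<r}. s < f t}"
  shows "\<bar>Inf J - y\<bar> + \<bar>Sup J - y\<bar> \<le> (Sup J - Inf J) + 2 * d"
proof -
  obtain t where t: "t \<in> J" using ne by (auto simp: J_def)
  have bdd: "bdd_above J" "bdd_below J" by (auto simp: J_def intro: bdd_aboveI[of _ r] bdd_belowI[of _ y])
  have "y \<le> Inf J" using t by (intro cInf_greatest) (auto simp: J_def)
  moreover have "Inf J \<le> t" "t \<le> Sup J" using bdd t by (auto intro: cInf_lower cSup_upper)
  moreover have "Inf J \<le> y + d"
  proof (cases "t \<le> y + d")
    case True then show ?thesis using \<open>Inf J \<le> t\<close> by linarith
  next
    case False
    have "Inf J \<le> z" if "y + d < z" "z < t" for z
    proof -
      have "f t \<le> f z"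
        using t c that by (intro monotone_onD[OF anti]) (auto simp: J_def)
      then have "z \<in> J" using t c that by (auto simp: J_def)
      then show ?thesis using bdd by (auto intro: cInf_lower)
    qed
    then show ?thesis using False by (intro dense_ge_bounded[of "y + d" t]) auto
  qed
  ultimately show ?thesis by linarith
qed

section \<open>Regular kernels\<close>

definition regular_kernel :: "(real \<Rightarrow> real) \<Rightarrow> bool" where
  "regular_kernel K \<longleftrightarrow> L_infinity_circle K \<and> (\<forall>t. 0 \<le> K t) \<and> antimono_on {0..pi} K \<and> mono_on {-pi..0} K"

lemma regular_kernel_periodic:
  assumes "regular_kernel K"
  shows "K (t + of_int k * (2 * pi)) = K t"
proof -
  interpret periodic_fun_simple K "2 * pi"
    using assms by (simp add: regular_kernel_def L_infinity_circle_def)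
  show ?thesis by (rule plus_of_int)
qed

text \<open>
  The variation measures live on the Borel sets, so Lebesgue measurability of the kernel is not enough for
  integration against them. Monotonicity on each half period gives Borel measurability.
\<close>

lemma regular_kernel_borel:
  assumes "regular_kernel K"
  shows "K \<in> borel_measurable borel"
proof (rule measurable_piecewise_restrict)
  let ?C = "range (\<lambda>k::int. {of_int k * (2 * pi)..of_int k * (2 * pi) + pi}) \<union>
    range (\<lambda>k::int. {of_int k * (2 * pi) - pi..of_int k * (2 * pi)})"
  show "countable ?C" by simp
  show "S \<inter> space borel \<in> sets borel" if "S \<in> ?C" for S
    using that by auto
  show "space borel \<subseteq> \<Union> ?C"
  proof -
    have "t \<in> \<Union> ?C" for t
    proof -
      define k where "k = \<lfloor>(t + pi) / (2 * pi)\<rfloor>"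
      have "of_int k \<le> (t + pi) / (2 * pi)" "(t + pi) / (2 * pi) < of_int k + 1"
        unfolding k_def by linarith+
      then have "of_int k * (2 * pi) - pi \<le> t" "t \<le> of_int k * (2 * pi) + pi"
        by (simp_all add: field_simps)
      then show ?thesis
        by (cases "t \<le> of_int k * (2 * pi)") auto
    qed
    then show ?thesis by (rule subsetI)
  qed
  have per: "K t = K (t - of_int k * (2 * pi))" for t k
    using regular_kernel_periodic[OF assms, of t "- k"] by simp
  show "K \<in> measurable (restrict_space borel S) borel" if "S \<in> ?C" for S
    using that
  proof
    assume "S \<in> range (\<lambda>k::int. {of_int k * (2 * pi)..of_int k * (2 * pi) + pi})"
    then obtain k :: int where S: "S = {of_int k * (2 * pi)..of_int k * (2 * pi) + pi}" by blast
    have anti: "antimono_on {0..pi} K" using assms by (simp add: regular_kernel_def)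
    have "mono_on S (\<lambda>t. - K t)"
    proof (rule mono_onI)
      fix a b assume "a \<in> S" "b \<in> S" "a \<le> b"
      then show "- K a \<le> - K b"
        using monotone_onD[OF anti, of "a - of_int k * (2 * pi)" "b - of_int k * (2 * pi)"] per[of _ k]
        by (simp add: S)
    qed
    then have "(\<lambda>t. - K t) \<in> borel_measurable (restrict_space borel S)"
      by (rule borel_measurable_mono_on_fnc)
    then have "(\<lambda>t. - (- K t)) \<in> borel_measurable (restrict_space borel S)"
      by (rule borel_measurable_uminus)
    then show ?thesis by simp
  next
    assume "S \<in> range (\<lambda>k::int. {of_int k * (2 * pi) - pi..of_int k * (2 * pi)})"
    then obtain k :: int where S: "S = {of_int k * (2 * pi) - pi..of_int k * (2 * pi)}" by blast
    have mono: "mono_on {-pi..0} K" using assms by (simp add: regular_kernel_def)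
    have "mono_on S K"
    proof (rule mono_onI)
      fix a b assume "a \<in> S" "b \<in> S" "a \<le> b"
      then show "K a \<le> K b"
        using mono_onD[OF mono, of "a - of_int k * (2 * pi)" "b - of_int k * (2 * pi)"] per[of _ k]
        by (simp add: S)
    qed
    then show ?thesis by (rule borel_measurable_mono_on_fnc)
  qed
qed

lemma regular_kernel_le_sup_norm:
  assumes "regular_kernel K"
  shows "K t \<le> sup_norm K"
proof -
  have "bounded (range K)" using assms by (simp add: regular_kernel_def L_infinity_circle_def)
  then obtain B where "\<And>t. \<bar>K t\<bar> \<le> B" by (auto simp: bounded_iff)
  then have "bdd_above (range (\<lambda>t. \<bar>K t\<bar>))" by (intro bdd_aboveI[of _ B]) auto
  then have "\<bar>K t\<bar> \<le> sup_norm K" unfolding sup_norm_def by (intro cSUP_upper) auto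
  then show ?thesis by linarith
qed

lemma regular_kernel_le_radial_majorant:
  assumes "regular_kernel K" "0 \<le> d" "d \<le> \<bar>u\<bar>" "\<bar>u\<bar> \<le> pi"
  shows "K u \<le> radial_majorant K d"
proof -
  have "\<bar>K t\<bar> \<le> sup_norm K" for t
    using regular_kernel_le_sup_norm[OF assms(1), of t] assms(1) by (simp add: regular_kernel_def)
  then have "\<bar>K u\<bar> \<le> radial_majorant K d" unfolding radial_majorant_def
    using assms(2-4) by (intro cSUP_upper) (auto intro!: bdd_aboveI[of _ "sup_norm K"])
  then show ?thesis by linarith
qed

section \<open>The estimate for a fixed kernel\<close>

lemma set_integrable_bounded_borel:
  fixes f :: "real \<Rightarrow> real"
  assumes M: "sets M = sets borel" and S: "S \<in> sets borel" "emeasure M S < \<infinity>"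
    and f: "f \<in> borel_measurable borel" "\<And>t. t \<in> S \<Longrightarrow> 0 \<le> f t \<and> f t \<le> B"
  shows "set_integrable M S f"
proof -
  have "f \<in> borel_measurable M"
    using f(1) measurable_cong_sets[OF M refl] by blast
  then show ?thesis
    unfolding set_integrable_def
    using S f(2) M by (intro integrableI_bounded_set_indicator[of _ _ _ B]) (auto intro!: AE_I2)
qed

lemma set_integral_bounds:
  fixes f :: "real \<Rightarrow> real"
  assumes M: "sets M = sets borel" and S: "S \<in> sets borel" "emeasure M S < \<infinity>"
    and f: "f \<in> borel_measurable borel" "\<And>t. t \<in> S \<Longrightarrow> 0 \<le> f t \<and> f t \<le> B"
  shows "0 \<le> (LINT t:S|M. f t)" and "(LINT t:S|M. f t) \<le> B * measure M S"
proof -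
  have int: "set_integrable M S f"
    by (rule set_integrable_bounded_borel[OF M S f])
  have const: "set_integrable M S (\<lambda>_. B)"
    using S M by (auto simp: set_integrable_def)
  show "0 \<le> (LINT t:S|M. f t)"
    unfolding set_lebesgue_integral_def using f(2) by (intro Bochner_Integration.integral_nonneg) (auto simp: indicator_def)
  have "(LINT t:S|M. f t) \<le> (LINT t:S|M. B)"
    using f(2) by (intro set_integral_mono int const) auto
  also have "\<dots> = B * measure M S"
    using S M sets_eq_imp_space_eq[OF M] by (simp add: set_lebesgue_integral_def)
  finally show "(LINT t:S|M. f t) \<le> B * measure M S" .
qed

lemma set_integral_reflect:
  fixes K :: "real \<Rightarrow> real"
  shows "(LINT t:S|lborel. K (c - t)) = (LINT u:(\<lambda>t. c - t) ` S|lborel. K u)"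
proof -
  have "indicator ((\<lambda>t. c - t) ` S) (c - t) = (indicator S t :: real)" for t
    by (auto simp: indicator_def)
  then show ?thesis
    unfolding set_lebesgue_integral_def
    by (subst (2) lborel_integral_real_affine[where c = "-1" and t = c]) auto
qed

lemma regular_kernel_reflect_unimodal:
  assumes K: "regular_kernel K" and S: "S \<subseteq> {c - pi..c + pi}"
  shows "mono_on (S \<inter> {..c}) (\<lambda>t. K (c - t))" and "antimono_on (S \<inter> {c..}) (\<lambda>t. K (c - t))"
proof -
  have anti: "antimono_on {0..pi} K" and mono: "mono_on {-pi..0} K"
    using K by (simp_all add: regular_kernel_def)
  show "mono_on (S \<inter> {..c}) (\<lambda>t. K (c - t))"
    using S by (intro mono_onI monotone_onD[OF anti]) auto
  show "antimono_on (S \<inter> {c..}) (\<lambda>t. K (c - t))"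
    using S by (intro monotone_onI mono_onD[OF mono]) auto
qed

text \<open>
  The point of evaluation is \<open>y1 + h\<close>. The circle \<open>(-\<pi>,\<pi>]\<close> is split into \<open>S1 = (y1 - \<delta>,y1]\<close>, \<open>S2 = (y2,y2 + \<delta>)\<close>
  and the rest \<open>F\<close>; the alternative among the hypotheses says that \<open>y1\<close> and \<open>y2\<close> represent the same point of
  the circle. The three summands of the bound come from the layer-cake estimate on \<open>S1\<close> and \<open>S2\<close>, from the
  majorant \<open>R\<close> of the kernel on \<open>F\<close>, and from replacing the Lebesgue integral of the kernel over \<open>S1 \<union> S2\<close> by \<open>1\<close>.
\<close>

lemma circle_kernel_estimate:
  fixes \<mu> K :: "real \<Rightarrow> real"
  defines "P \<equiv> positive_variation_measure \<mu>" and "N \<equiv> positive_variation_measure (\<lambda>t. - \<mu> t)"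
  assumes BV: "BV_circle \<mu>" and K: "regular_kernel K"
    and \<delta>: "0 < \<delta>" "2 * \<delta> \<le> pi" and h: "\<bar>h\<bar> \<le> d" "2 * d \<le> \<delta>" and e: "0 \<le> e"
    and y: "-pi \<le> y1 - \<delta>" "y1 \<le> pi" "-pi \<le> y2" "y2 + \<delta> \<le> pi"
      "y1 = y2 \<and> y1 + \<delta> \<le> pi \<and> -pi \<le> y2 - \<delta> \<or> y1 = pi \<and> y2 = -pi"
    and left: "\<And>a b. y1 - \<delta> \<le> a \<Longrightarrow> a \<le> b \<Longrightarrow> b \<le> y1 \<Longrightarrow>
      \<bar>measure P {a<..b} - measure N {a<..b} - A * (b - a)\<bar> \<le> e * (\<bar>a - y1\<bar> + \<bar>b - y1\<bar>)"
    and right: "\<And>a b. y2 \<le> a \<Longrightarrow> a \<le> b \<Longrightarrow> b \<le> y2 + \<delta> \<Longrightarrow>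
      \<bar>measure P {a<..b} - measure N {a<..b} - A * (b - a)\<bar> \<le> e * (\<bar>a - y2\<bar> + \<bar>b - y2\<bar>)"
  defines "I \<equiv> (LINT t:{-pi..pi}|lebesgue. K t)" and "R \<equiv> radial_majorant K (\<delta> / 2)"
  shows "\<bar>circle_stieltjes_integral \<mu> (\<lambda>t. K (y1 + h - t)) - A\<bar> \<le>
    e * (I + 4 * d * sup_norm K) + R * (measure P {-pi<..pi} + measure N {-pi<..pi})
      + \<bar>A\<bar> * (\<bar>I - 1\<bar> + 2 * pi * R)"
proof -
  note BV' = BV_circle_uminus[OF BV]
  define f where "f t = K (y1 + h - t)" for t
  define S1 S2 F where "S1 = {y1 - \<delta><..y1}" and "S2 = {y2<..<y2 + \<delta>}" and "F = {-pi<..pi} - S1 - S2"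
  have [measurable]: "K \<in> borel_measurable borel" by (rule regular_kernel_borel[OF K])
  have f_borel [measurable]: "f \<in> borel_measurable borel" unfolding f_def by measurable
  have K0: "0 \<le> K t" and KB: "K t \<le> sup_norm K" for t
    using K regular_kernel_le_sup_norm[OF K] by (auto simp: regular_kernel_def)
  have f_bd: "0 \<le> f t \<and> f t \<le> sup_norm K" for t
    using K0 KB by (simp add: f_def)
  have B: "0 \<le> sup_norm K" using K0[of 0] KB[of 0] by linarith
  have R: "K u \<le> R" if "\<delta> / 2 \<le> \<bar>u\<bar>" "\<bar>u\<bar> \<le> pi" for u
    unfolding R_def using that \<delta> by (intro regular_kernel_le_radial_majorant[OF K]) auto
  have R0: "0 \<le> R" using R[of pi] K0[of pi] \<delta> by auto
  have K_shift: "K (t + 2 * pi) = K t" "K (t - 2 * pi) = K t" for t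
    using regular_kernel_periodic[OF K, of t 1] regular_kernel_periodic[OF K, of t "-1"] by simp_all
  have f2: "f t = K (y2 + h - t)" for t
    using y(5) K_shift(1)[of "h - pi - t"] by (auto simp: f_def algebra_simps)
  have borel: "S1 \<in> sets borel" "S2 \<in> sets borel" "F \<in> sets borel"
    by (auto simp: S1_def S2_def F_def)
  have sub: "S1 \<subseteq> {-pi<..pi}" "S2 \<subseteq> {-pi<..pi}" "F \<subseteq> {-pi<..pi}"
    using y by (auto simp: S1_def S2_def F_def)
  have disj: "S1 \<inter> S2 = {}" using y \<delta> by (auto simp: S1_def S2_def)
  have far: "f t \<le> R" if "t \<in> F" for t
  proof -
    have t: "-pi < t" "t \<le> pi" "\<not> (y1 - \<delta> < t \<and> t \<le> y1)" "\<not> (y2 < t \<and> t < y2 + \<delta>)"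
      using that by (auto simp: F_def S1_def S2_def)
    \<comment> \<open>The distance from \<open>t\<close> to \<open>y1\<close> on the circle is at least \<open>\<delta>\<close>, hence at least \<open>\<delta>/2\<close> from \<open>y1 + h\<close>.\<close>
    then have "\<delta> \<le> \<bar>y1 - t\<bar> \<and> \<bar>y1 - t\<bar> \<le> 2 * pi - \<delta>"
      using y \<delta> by (elim disjE conjE; linarith)
    then have w: "\<delta> / 2 \<le> \<bar>y1 + h - t\<bar>" "\<bar>y1 + h - t\<bar> \<le> 2 * pi - \<delta> / 2"
      using h by linarith+
    consider "\<bar>y1 + h - t\<bar> \<le> pi" | "pi < y1 + h - t" | "y1 + h - t < - pi" by linarith
    then show ?thesis
    proof cases
      case 1 then show ?thesis using R w by (simp add: f_def)
    next
      case 2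
      have "K (y1 + h - t - 2 * pi) \<le> R" by (rule R) (use 2 w \<delta> in linarith)+
      then show ?thesis by (simp add: f_def K_shift)
    next
      case 3
      have "K (y1 + h - t + 2 * pi) \<le> R" by (rule R) (use 3 w \<delta> in linarith)+
      then show ?thesis by (simp add: f_def K_shift)
    qed
  qed
  have split: "(LINT t:{-pi<..pi}|M. f t) = (LINT t:S1|M. f t) + (LINT t:S2|M. f t) + (LINT t:F|M. f t)"
    and far_bound: "0 \<le> (LINT t:F|M. f t)" "(LINT t:F|M. f t) \<le> R * measure M {-pi<..pi}"
    if M: "sets M = sets borel" and fin: "emeasure M {-pi<..pi} < \<infinity>" for M
  proof -
    have finS: "emeasure M S < \<infinity>" if "S \<subseteq> {-pi<..pi}" for S
      by (rule le_less_trans[OF emeasure_mono[OF that] fin]) (simp add: M)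
    have int: "set_integrable M S f" if "S \<in> sets borel" "S \<subseteq> {-pi<..pi}" for S
      by (rule set_integrable_bounded_borel[OF M that(1) finS[OF that(2)] f_borel f_bd])
    have "{-pi<..pi} = (S1 \<union> S2) \<union> F" using sub by (auto simp: F_def)
    moreover have "(LINT t:(S1 \<union> S2) \<union> F|M. f t) = (LINT t:S1 \<union> S2|M. f t) + (LINT t:F|M. f t)"
      using sub borel by (intro set_integral_Un int) (auto simp: F_def)
    moreover have "(LINT t:S1 \<union> S2|M. f t) = (LINT t:S1|M. f t) + (LINT t:S2|M. f t)"
      using sub borel disj by (intro set_integral_Un int) auto
    ultimately show "(LINT t:{-pi<..pi}|M. f t) = (LINT t:S1|M. f t) + (LINT t:S2|M. f t) + (LINT t:F|M. f t)"
      by simp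
    have "0 \<le> f t \<and> f t \<le> R" if "t \<in> F" for t using far[OF that] f_bd by simp
    note bounds = set_integral_bounds[OF M borel(3) finS[OF sub(3)] f_borel this]
    show "0 \<le> (LINT t:F|M. f t)" by (rule bounds(1))
    have "measure M F \<le> measure M {-pi<..pi}"
      using sub(3) fin by (intro measure_mono_fmeasurable) (auto simp: fmeasurable_def M borel)
    then have "R * measure M F \<le> R * measure M {-pi<..pi}" using R0 by (rule mult_left_mono)
    then show "(LINT t:F|M. f t) \<le> R * measure M {-pi<..pi}" using bounds(2) by linarith
  qed
  have P: "sigma_finite_measure P" "sets P = sets borel" "emeasure P {a<..b} < \<infinity>"
    and N: "sigma_finite_measure N" "sets N = sets borel" "emeasure N {a<..b} < \<infinity>" for a b
    unfolding P_def N_def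
    using sigma_finite_positive_variation_measure emeasure_positive_variation_measure_Ioc BV BV' by auto
  have piece1: "\<bar>(LINT t:S1|P. f t) - (LINT t:S1|N. f t) - A * (LINT t:S1|lborel. f t)\<bar>
    \<le> e * ((LINT t:S1|lborel. f t) + 2 * d * sup_norm K)"
  proof (rule signed_integral_estimate[OF P N left])
    fix s assume ne: "{t\<in>S1. s < f t} \<noteq> {}"
    have "S1 \<subseteq> {y1 + h - pi..y1 + h + pi}" using h \<delta> by (auto simp: S1_def)
    note uni = regular_kernel_reflect_unimodal[OF K this, folded f_def]
    have "is_interval {t\<in>S1. s < f t}"
      by (rule unimodal_superlevel_interval[OF _ uni]) (auto simp: S1_def is_interval_1)
    then show "is_interval {t\<in>S1. s < f t} \<and> \<bar>Inf {t\<in>S1. s < f t} - y1\<bar> + \<bar>Sup {t\<in>S1. s < f t} - y1\<bar> \<le>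
        (Sup {t\<in>S1. s < f t} - Inf {t\<in>S1. s < f t}) + 2 * d"
      using unimodal_superlevel_left[of "y1 - \<delta>" y1 "y1 + h" f s d] uni(1) ne h unfolding S1_def by simp
  qed (use borel e h B f_bd f_borel in \<open>auto simp: S1_def\<close>)
  have piece2: "\<bar>(LINT t:S2|P. f t) - (LINT t:S2|N. f t) - A * (LINT t:S2|lborel. f t)\<bar>
    \<le> e * ((LINT t:S2|lborel. f t) + 2 * d * sup_norm K)"
  proof (rule signed_integral_estimate[OF P N right])
    fix s assume ne: "{t\<in>S2. s < f t} \<noteq> {}"
    have "S2 \<subseteq> {y2 + h - pi..y2 + h + pi}" using h \<delta> by (auto simp: S2_def)
    note uni = regular_kernel_reflect_unimodal[OF K this, folded f2]
    have "is_interval {t\<in>S2. s < f t}"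
      by (rule unimodal_superlevel_interval[OF _ uni]) (auto simp: S2_def is_interval_1)
    then show "is_interval {t\<in>S2. s < f t} \<and> \<bar>Inf {t\<in>S2. s < f t} - y2\<bar> + \<bar>Sup {t\<in>S2. s < f t} - y2\<bar> \<le>
        (Sup {t\<in>S2. s < f t} - Inf {t\<in>S2. s < f t}) + 2 * d"
      using unimodal_superlevel_right[of y2 "y2 + \<delta>" "y2 + h" f s d] uni(2) ne h unfolding S2_def by simp
  qed (use borel e h B f_bd f_borel in \<open>auto simp: S2_def\<close>)
  \<comment> \<open>Reflected at the point of evaluation, \<open>S1\<close> and \<open>S2\<close> become the two halves of \<open>(h - \<delta>,h + \<delta>)\<close>, so \<open>Q\<close> is
    the integral of the kernel over all of \<open>[-\<pi>,\<pi>]\<close> up to points where the kernel is at most \<open>R\<close>.\<close>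
  define Q where "Q = (LINT t:S1|lborel. f t) + (LINT t:S2|lborel. f t)"
  have Q: "0 \<le> I - Q" "I - Q \<le> R * (2 * pi)"
  proof -
    define G where "G = {-pi..pi} - {h - \<delta><..<h + \<delta>}"
    have int: "set_integrable lborel S K" if "S \<in> sets borel" "S \<subseteq> {-pi..pi}" for S
    proof (rule set_integrable_bounded_borel[of lborel S K "sup_norm K"])
      show "emeasure lborel S < \<infinity>" 
        by (rule le_less_trans[OF emeasure_mono[OF that(2)]]) simp_all
    qed (use K0 KB that in auto)
    have "(LINT t:S1|lborel. f t) = (LINT u:{h..<h + \<delta>}|lborel. K u)"
    proof -
      have "(\<lambda>t. y1 + h - t) ` S1 = {h..<h + \<delta>}"
        unfolding S1_def by (auto intro!: image_eqI[of _ _ "y1 + h - x" for x])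
      then show ?thesis unfolding f_def set_integral_reflect by simp
    qed
    moreover have "(LINT t:S2|lborel. f t) = (LINT u:{h - \<delta><..<h}|lborel. K u)"
    proof -
      have "(\<lambda>t. y2 + h - t) ` S2 = {h - \<delta><..<h}"
        unfolding S2_def by (auto intro!: image_eqI[of _ _ "y2 + h - x" for x])
      then show ?thesis unfolding f2 set_integral_reflect by simp
    qed
    moreover have "(LINT u:{h - \<delta><..<h} \<union> {h..<h + \<delta>}|lborel. K u) =
        (LINT u:{h - \<delta><..<h}|lborel. K u) + (LINT u:{h..<h + \<delta>}|lborel. K u)"
      using h \<delta> by (intro set_integral_Un int) auto
    moreover have "{h - \<delta><..<h} \<union> {h..<h + \<delta>} = {h - \<delta><..<h + \<delta>}" using \<delta> by auto
    ultimately have "Q = (LINT u:{h - \<delta><..<h + \<delta>}|lborel. K u)" by (simp add: Q_def)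
    moreover have "I = (LINT u:{-pi..pi}|lborel. K u)"
      unfolding I_def set_lebesgue_integral_def by (rule integral_completion) measurable
    moreover have "(LINT u:{h - \<delta><..<h + \<delta>} \<union> G|lborel. K u) = 
        (LINT u:{h - \<delta><..<h + \<delta>}|lborel. K u) + (LINT u:G|lborel. K u)"
      using h \<delta> by (intro set_integral_Un int) (auto simp: G_def)
    moreover have "{h - \<delta><..<h + \<delta>} \<union> G = {-pi..pi}" using h \<delta> by (auto simp: G_def)
    ultimately have "I - Q = (LINT u:G|lborel. K u)" by simp
    moreover have finG: "emeasure lborel G < \<infinity>"
      by (rule le_less_trans[OF emeasure_mono[of G "{-pi..pi}"]]) (auto simp: G_def)
    moreover have "0 \<le> K u \<and> K u \<le> R" if "u \<in> G" for u
      using that h \<delta> K0[of u] by (intro conjI R) (auto simp: G_def)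
    moreover have "G \<in> sets borel" by (auto simp: G_def)
    ultimately have "0 \<le> I - Q" "I - Q \<le> R * measure lborel G"
      using set_integral_bounds[of lborel G K R] by auto
    moreover have "measure lborel G \<le> measure lborel {-pi..pi}"
      by (rule measure_mono_fmeasurable) (auto simp: G_def fmeasurable_def)
    then have "R * measure lborel G \<le> R * (2 * pi)"
      using R0 by (intro mult_left_mono) auto
    ultimately show "0 \<le> I - Q" "I - Q \<le> R * (2 * pi)" by linarith+
  qed
  have "\<bar>circle_stieltjes_integral \<mu> f - A * Q\<bar> \<le> e * (Q + 4 * d * sup_norm K)
      + R * (measure P {-pi<..pi} + measure N {-pi<..pi})"
  proof -
    have "circle_stieltjes_integral \<mu> f = (LINT t:{-pi<..pi}|P. f t) - (LINT t:{-pi<..pi}|N. f t)"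
      by (simp add: circle_stieltjes_integral_def P_def N_def)
    then show ?thesis
      using piece1 piece2 split[OF P(2,3)] split[OF N(2,3)] far_bound[OF P(2,3)] far_bound[OF N(2,3)]
      by (simp add: Q_def algebra_simps abs_le_iff) 
  qed
  moreover have "e * (Q + 4 * d * sup_norm K) \<le> e * (I + 4 * d * sup_norm K)"
    using Q(1) e by (intro mult_left_mono) auto
  moreover have "\<bar>A * Q - A\<bar> \<le> \<bar>A\<bar> * (\<bar>I - 1\<bar> + 2 * pi * R)"
  proof -
    have "\<bar>Q - 1\<bar> \<le> \<bar>I - 1\<bar> + 2 * pi * R" using Q by (simp add: mult.commute)
    then have "\<bar>A\<bar> * \<bar>Q - 1\<bar> \<le> \<bar>A\<bar> * (\<bar>I - 1\<bar> + 2 * pi * R)" by (rule mult_left_mono) simp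
    then show ?thesis by (simp add: abs_mult[symmetric] right_diff_distrib)
  qed
  ultimately show ?thesis unfolding f_def[symmetric] by linarith
qed

section \<open>Convergence\<close>

text \<open>
  Subtracting the linear function with the same increment over a period makes \<open>\<mu>\<close> periodic, so its translates
  by periods differ by constants.
\<close>

lemma BV_circle_derivative_shift:
  assumes BV: "BV_circle \<mu>" and D: "(\<mu> has_real_derivative A) (at (y + of_int k * (2 * pi)))"
  shows "(\<mu> has_real_derivative A) (at y)"
proof -
  obtain c where c: "\<And>t. \<mu> (t + 2 * pi) = \<mu> t + c"
    using BV by (auto simp: BV_circle_def)
  interpret periodic_fun_simple "\<lambda>t. \<mu> t - c / (2 * pi) * t" "2 * pi"
    by standard (simp add: c distrib_left)
  have "\<mu> (t + of_int k * (2 * pi)) - of_int k * c = \<mu> t" for t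
    using plus_of_int[of t k] by (simp add: distrib_left mult.commute)
  moreover have "((\<lambda>t. \<mu> (t + of_int k * (2 * pi)) - of_int k * c) has_real_derivative A) (at y)"
    using DERIV_diff[OF D[unfolded DERIV_shift] DERIV_const] by simp
  ultimately show ?thesis by simp
qed

lemma region_limitI:
  assumes lam: "\<forall>r\<in>{0<..<1}. 0 < lam r"
    and bound: "\<And>\<eta>. 0 < \<eta> \<Longrightarrow> \<forall>\<^sub>F r in at_left 1. \<forall>\<theta>\<in>{x - lam r..x + lam r}. \<bar>F r \<theta> - A\<bar> \<le> \<eta>"
  shows "region_limit F lam x A"
  unfolding region_limit_def
proof (rule order_tendstoI)
  fix a :: ereal assume a: "a < 0"
  have "\<forall>\<^sub>F r in at_left (1::real). r \<in> {0<..<1}"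
    by (rule eventually_at_leftI[of 0]) auto
  then show "\<forall>\<^sub>F r in at_left 1. a < (SUP \<theta>\<in>{x - lam r..x + lam r}. ereal \<bar>F r \<theta> - A\<bar>)"
  proof (rule eventually_mono)
    fix r :: real assume "r \<in> {0<..<1}"
    then have "0 < lam r" using lam by blast
    then have "x \<in> {x - lam r..x + lam r}" by simp
    then have "ereal \<bar>F r x - A\<bar> \<le> (SUP \<theta>\<in>{x - lam r..x + lam r}. ereal \<bar>F r \<theta> - A\<bar>)"
      by (rule SUP_upper)
    moreover have "a < ereal \<bar>F r x - A\<bar>" using a by (rule less_le_trans) simp
    ultimately show "a < (SUP \<theta>\<in>{x - lam r..x + lam r}. ereal \<bar>F r \<theta> - A\<bar>)" by simp
  qed
next
  fix a :: ereal assume "0 < a"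
  then obtain \<eta> where \<eta>: "0 < ereal \<eta>" "ereal \<eta> < a" using ereal_dense2 by blast
  then have "0 < \<eta>" by simp
  from bound[OF this]
  show "\<forall>\<^sub>F r in at_left 1. (SUP \<theta>\<in>{x - lam r..x + lam r}. ereal \<bar>F r \<theta> - A\<bar>) < a"
  proof (rule eventually_mono)
    fix r assume "\<forall>\<theta>\<in>{x - lam r..x + lam r}. \<bar>F r \<theta> - A\<bar> \<le> \<eta>"
    then have "(SUP \<theta>\<in>{x - lam r..x + lam r}. ereal \<bar>F r \<theta> - A\<bar>) \<le> ereal \<eta>"
      by (intro SUP_least) simp
    then show "(SUP \<theta>\<in>{x - lam r..x + lam r}. ereal \<bar>F r \<theta> - A\<bar>) < a"
      using \<eta>(2) by (rule le_less_trans)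
  qed
qed

theorem theorem1p1:
  fixes \<phi> :: "real \<Rightarrow> real \<Rightarrow> real" and lam :: "real \<Rightarrow> real"
    and \<mu> :: "real \<Rightarrow> real" and x\<^sub>0 :: real
  assumes "regular_approximate_identity \<phi>"
    and "\<forall>r\<in>{0<..<1}. 0 < lam r"
    and "(lam \<longlongrightarrow> 0) (at_left 1)"
    and "Pi_limsup lam \<phi> < \<infinity>"
    and "BV_circle \<mu>"
    and "\<mu> differentiable (at x\<^sub>0)"
  shows "region_limit (kernel_integral \<phi> \<mu>) lam x\<^sub>0 (deriv \<mu> x\<^sub>0)"
proof (rule region_limitI[OF assms(2)])
  fix \<eta> :: real assume \<eta>: "0 < \<eta>"
  note BV = assms(5)
  define A where "A = deriv \<mu> x\<^sub>0"
  have DA: "(\<mu> has_real_derivative A) (at x\<^sub>0)"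
    using assms(6) by (simp add: A_def DERIV_deriv_iff_real_differentiable)
  define k where "k = \<lceil>(x\<^sub>0 - pi) / (2 * pi)\<rceil>"
  define y1 where "y1 = x\<^sub>0 - of_int k * (2 * pi)"
  have "(x\<^sub>0 - pi) / (2 * pi) \<le> of_int k" "of_int k < (x\<^sub>0 - pi) / (2 * pi) + 1"
    unfolding k_def by linarith+
  then have y1: "-pi < y1" "y1 \<le> pi"
    by (simp_all add: y1_def field_simps)
  define y2 where "y2 = (if y1 = pi then -pi else y1)"
  have D1: "(\<mu> has_real_derivative A) (at y1)"
    using BV_circle_derivative_shift[OF BV, of A y1 k] DA by (simp add: y1_def)
  have D2: "(\<mu> has_real_derivative A) (at y2)"
    using BV_circle_derivative_shift[OF BV, of A y2 1] D1 by (auto simp: y2_def)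
  obtain C where "Pi_limsup lam \<phi> < ereal C"
    using ereal_dense2[OF assms(4)] by blast
  then have C: "\<forall>\<^sub>F r in at_left 1. lam r * sup_norm (\<phi> r) \<le> max 0 C"
    unfolding Pi_limsup_def by (auto dest!: Limsup_lessD elim!: eventually_mono)
  \<comment> \<open>With this choice the layer-cake term \<open>e (\<integral> \<phi>\<^sub>r + 4 \<lambda>(r) \<parallel>\<phi>\<^sub>r\<parallel>)\<close> is at most \<open>\<eta>/2\<close> once \<open>\<integral> \<phi>\<^sub>r \<le> 2\<close>.\<close>
  define e where "e = \<eta> / (2 * (2 + 4 * max 0 C))"
  have e: "0 < e" "e * (2 + 4 * max 0 C) = \<eta> / 2"
    using \<eta> by (auto simp: e_def field_simps)
  let ?P = "positive_variation_measure \<mu>" and ?N = "positive_variation_measure (\<lambda>t. - \<mu> t)"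
  obtain \<rho>1 where \<rho>1: "\<rho>1 > 0" "\<And>a b. -pi \<le> a \<Longrightarrow> a \<le> b \<Longrightarrow> \<bar>a - y1\<bar> < \<rho>1 \<Longrightarrow> \<bar>b - y1\<bar> < \<rho>1 \<Longrightarrow>
      \<bar>measure ?P {a<..b} - measure ?N {a<..b} - A * (b - a)\<bar> \<le> e * (\<bar>a - y1\<bar> + \<bar>b - y1\<bar>)"
    using jordan_measure_derivative[OF BV D1 e(1)] by blast
  obtain \<rho>2 where \<rho>2: "\<rho>2 > 0" "\<And>a b. -pi \<le> a \<Longrightarrow> a \<le> b \<Longrightarrow> \<bar>a - y2\<bar> < \<rho>2 \<Longrightarrow> \<bar>b - y2\<bar> < \<rho>2 \<Longrightarrow>
      \<bar>measure ?P {a<..b} - measure ?N {a<..b} - A * (b - a)\<bar> \<le> e * (\<bar>a - y2\<bar> + \<bar>b - y2\<bar>)"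
    using jordan_measure_derivative[OF BV D2 e(1)] by blast
  have y2: "-pi \<le> y2" "y2 < pi" using y1 by (auto simp: y2_def)
  define \<delta> where "\<delta> = Min {\<rho>1 / 2, \<rho>2 / 2, pi / 2, y1 + pi, pi - y2}"
  have "0 < \<delta>" using \<rho>1(1) \<rho>2(1) y1 y2 by (auto simp: \<delta>_def)
  moreover have "\<delta> \<le> pi / 2" "\<delta> \<le> \<rho>1 / 2" "\<delta> \<le> \<rho>2 / 2" "\<delta> \<le> y1 + pi" "\<delta> \<le> pi - y2"
    unfolding \<delta>_def by (rule Min_le; simp)+
  ultimately have \<delta>: "0 < \<delta>" "\<delta> \<le> \<rho>1 / 2" "\<delta> \<le> \<rho>2 / 2" "2 * \<delta> \<le> pi" "\<delta> \<le> y1 + pi" "\<delta> \<le> pi - y2"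
    by simp_all
  define I where "I r = (LINT t:{-pi..pi}|lebesgue. \<phi> r t)" for r
  define R where "R r = radial_majorant (\<phi> r) (\<delta> / 2)" for r
  define T where "T = measure ?P {-pi<..pi} + measure ?N {-pi<..pi}"
  have AI: "approximate_identity \<phi>"
    using assms(1) by (simp add: regular_approximate_identity_def)
  have I: "(I \<longlongrightarrow> 1) (at_left 1)"
    using AI by (simp add: approximate_identity_def I_def[abs_def])
  have R: "(R \<longlongrightarrow> 0) (at_left 1)"
    using AI \<delta> by (simp add: approximate_identity_def R_def[abs_def])
  have "((\<lambda>r. R r * T + \<bar>A\<bar> * (\<bar>I r - 1\<bar> + 2 * pi * R r)) \<longlongrightarrow> 0 * T + \<bar>A\<bar> * (\<bar>1 - 1\<bar> + 2 * pi * 0)) (at_left 1)"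
    by (intro tendsto_intros I R)
  then have small: "\<forall>\<^sub>F r in at_left 1. R r * T + \<bar>A\<bar> * (\<bar>I r - 1\<bar> + 2 * pi * R r) < \<eta> / 2"
    using \<eta> by (intro order_tendstoD(2)) auto
  have I2: "\<forall>\<^sub>F r in at_left 1. I r < 2" by (rule order_tendstoD(2)[OF I]) simp
  have lam: "\<forall>\<^sub>F r in at_left 1. lam r < \<delta> / 2" by (rule order_tendstoD(2)[OF assms(3)]) (use \<delta> in simp)
  have r01: "\<forall>\<^sub>F r in at_left (1::real). r \<in> {0<..<1}"
    by (rule eventually_at_leftI[of 0]) auto
  show "\<forall>\<^sub>F r in at_left 1. \<forall>\<theta>\<in>{x\<^sub>0 - lam r..x\<^sub>0 + lam r}. \<bar>kernel_integral \<phi> \<mu> r \<theta> - deriv \<mu> x\<^sub>0\<bar> \<le> \<eta>"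
    using small I2 lam r01 C
  proof eventually_elim
    case (elim r)
    have K: "regular_kernel (\<phi> r)"
      using assms(1) elim(4) by (simp add: regular_kernel_def regular_approximate_identity_def approximate_identity_def)
    show ?case
    proof
      fix \<theta> assume \<theta>: "\<theta> \<in> {x\<^sub>0 - lam r..x\<^sub>0 + lam r}"
      define h where "h = \<theta> - x\<^sub>0"
      have "\<phi> r (\<theta> - t) = \<phi> r (y1 + h - t)" for t
        using regular_kernel_periodic[OF K, of "y1 + h - t" k] by (simp add: h_def y1_def algebra_simps)
      then have "kernel_integral \<phi> \<mu> r \<theta> = circle_stieltjes_integral \<mu> (\<lambda>t. \<phi> r (y1 + h - t))"
        by (simp add: kernel_integral_def)
      moreover have "\<bar>circle_stieltjes_integral \<mu> (\<lambda>t. \<phi> r (y1 + h - t)) - A\<bar> \<le>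
          e * (I r + 4 * lam r * sup_norm (\<phi> r)) + R r * T + \<bar>A\<bar> * (\<bar>I r - 1\<bar> + 2 * pi * R r)"
        unfolding I_def R_def T_def
      proof (rule circle_kernel_estimate[OF BV K \<delta>(1,4), of h "lam r" e y1 y2 A])
        show "\<bar>h\<bar> \<le> lam r" using \<theta> by (auto simp: h_def)
        show "y1 = y2 \<and> y1 + \<delta> \<le> pi \<and> - pi \<le> y2 - \<delta> \<or> y1 = pi \<and> y2 = - pi"
          using \<delta> by (auto simp: y2_def)
      next
        fix a b assume "y1 - \<delta> \<le> a" "a \<le> b" "b \<le> y1"
        then show "\<bar>measure ?P {a<..b} - measure ?N {a<..b} - A * (b - a)\<bar> \<le> e * (\<bar>a - y1\<bar> + \<bar>b - y1\<bar>)"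
          using \<delta> \<rho>1(1) by (intro \<rho>1(2)) auto
      next
        fix a b assume "y2 \<le> a" "a \<le> b" "b \<le> y2 + \<delta>"
        then show "\<bar>measure ?P {a<..b} - measure ?N {a<..b} - A * (b - a)\<bar> \<le> e * (\<bar>a - y2\<bar> + \<bar>b - y2\<bar>)"
          using \<delta> \<rho>2(1) y2 by (intro \<rho>2(2)) auto
      qed (use elim \<delta> y1 y2 e in auto)
      moreover have "e * (I r + 4 * lam r * sup_norm (\<phi> r)) \<le> e * (2 + 4 * max 0 C)"
        using elim e(1) by (intro mult_left_mono) (auto simp: algebra_simps)
      ultimately show "\<bar>kernel_integral \<phi> \<mu> r \<theta> - deriv \<mu> x\<^sub>0\<bar> \<le> \<eta>"
        using elim(1) e(2) by (simp add: A_def)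
    qed
  qed
qed

end
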